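(* Let $p$ be an odd prime and $d\in\mathbb{F}_p$, $d\neq 0,1$, such that $\sum_{j=0}^{\frac{p-1}{2}}\left(C_{\frac{p-1}{2}}^{j}\right)^2 d^j \equiv 0 \pmod p$. Let $n\ge 1$. If $n$ is odd, then $\overline{N}_{d[p^n]} = p^n+1$ and $N_{d[p^n]} = p^n-1-2\left(\frac{d}{p}\right)$. If $n$ is even, then $N_{d[p^n]} = p^n-3-2(-p)^{n/2}$ and $\overline{N}_{d[p^n]} = p^n+1-2(-p)^{n/2}$.
   Context: $E_d$ is the Edwards curve $x^2+y^2=1+dx^2y^2$. $N_{d[p^n]}$ is the number of affine solutions $(x,y)\in\mathbb{F}_{p^n}^2$ of this equation. $\overline{N}_{d[p^n]}$ is the number of points over $\mathbb{F}_{p^n}$ of the projective curve completed by its points at infinity, i.e. of the nonsingular projective model of $E_d$ (equivalently, of the elliptic curve $v^2=(d-1)u^3+2(d+1)u^2+(d-1)u$ including its point at infinity). $C_n^j=\binom{n}{j}$ and $\left(\frac{d}{p}\right)$ is the Legendre symbol. *)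

theory Defs
  imports "HOL-Number_Theory.Number_Theory" "HOL-Library.Cardinality"
begin

definition edwards_affine :: "'a::field \<Rightarrow> ('a \<times> 'a) set" where
  "edwards_affine d = {(x, y). x\<^sup>2 + y\<^sup>2 = 1 + d * x\<^sup>2 * y\<^sup>2}"

text \<open>The point \<open>(X : Y : Z : T)\<close> of projective 3-space over the base field.\<close>

definition proj3_point :: "'a::field \<times> 'a \<times> 'a \<times> 'a \<Rightarrow> ('a \<times> 'a \<times> 'a \<times> 'a) set" where
  "proj3_point = (\<lambda>(X, Y, Z, T). {(c * X, c * Y, c * Z, c * T) | c. c \<noteq> 0})"

text \<open>
  The nonsingular projective model.  The closure of the affine curve in the projective plane is
  singular at its points at infinity \<open>(1 : 0 : 0)\<close> and \<open>(0 : 1 : 0)\<close>, so the affine curve is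
  completed instead as a curve in 3-space, along the embedding \<open>(x, y) \<mapsto> (x : y : 1 : x y)\<close>; the
  plane \<open>Z = 0\<close> cuts out the points at infinity.  The lemmas below show that the affine part is
  exactly \<open>edwards_affine d\<close> (\<open>edwards_completed_eq\<close>), that the model is nonsingular for \<open>d \<noteq> 0, 1\<close>
  in odd characteristic (\<open>edwards_nonsingular\<close>), and that it has as many points as the elliptic
  curve \<open>v\<^sup>2 = (d - 1) u\<^sup>3 + 2 (d + 1) u\<^sup>2 + (d - 1) u\<close> with its point at infinity
  (\<open>card_edwards_completed_elliptic\<close>).
\<close>

definition edwards_completed :: "'a::field \<Rightarrow> ('a \<times> 'a \<times> 'a \<times> 'a) set set" where
  "edwards_completed d = proj3_point `
     {(X, Y, Z, T). (X, Y, Z, T) \<noteq> (0, 0, 0, 0) \<and> X\<^sup>2 + Y\<^sup>2 = Z\<^sup>2 + d * T\<^sup>2 \<and> X * Y = Z * T}"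

definition edwards_elliptic_affine :: "'a::field \<Rightarrow> ('a \<times> 'a) set" where
  "edwards_elliptic_affine d =
     {(u, v). v\<^sup>2 = (d - 1) * u ^ 3 + 2 * (d + 1) * u\<^sup>2 + (d - 1) * u}"

lemma proj3_point_eq_iff:
  "proj3_point (X, Y, Z, T) = proj3_point (X', Y', Z', T') \<longleftrightarrow>
     (\<exists>c. c \<noteq> 0 \<and> X' = c * X \<and> Y' = c * Y \<and> Z' = c * Z \<and> T' = c * T)"
proof
  assume eq: "proj3_point (X, Y, Z, T) = proj3_point (X', Y', Z', T')"
  have "(X', Y', Z', T') \<in> proj3_point (X', Y', Z', T')"
    unfolding proj3_point_def by (auto intro!: exI[of _ 1])
  hence "(X', Y', Z', T') \<in> proj3_point (X, Y, Z, T)" using eq by simp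
  thus "\<exists>c. c \<noteq> 0 \<and> X' = c * X \<and> Y' = c * Y \<and> Z' = c * Z \<and> T' = c * T"
    unfolding proj3_point_def by auto
next
  assume "\<exists>c. c \<noteq> 0 \<and> X' = c * X \<and> Y' = c * Y \<and> Z' = c * Z \<and> T' = c * T"
  then obtain c where c: "c \<noteq> 0" "X' = c * X" "Y' = c * Y" "Z' = c * Z" "T' = c * T" by blast
  have "p \<in> proj3_point (X, Y, Z, T)" if p: "p \<in> proj3_point (X', Y', Z', T')" for p
  proof -
    from p obtain e where "e \<noteq> 0" "p = (e * X', e * Y', e * Z', e * T')"
      unfolding proj3_point_def by auto
    hence "e * c \<noteq> 0" "p = (e * c * X, e * c * Y, e * c * Z, e * c * T)"
      using c by (simp_all add: mult.assoc)
    thus ?thesis unfolding proj3_point_def by blast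
  qed
  moreover have "p \<in> proj3_point (X', Y', Z', T')" if p: "p \<in> proj3_point (X, Y, Z, T)" for p
  proof -
    from p obtain e where "e \<noteq> 0" "p = (e * X, e * Y, e * Z, e * T)"
      unfolding proj3_point_def by auto
    hence "e / c \<noteq> 0" "p = (e / c * X', e / c * Y', e / c * Z', e / c * T')"
      using c by simp_all
    thus ?thesis unfolding proj3_point_def by blast
  qed
  ultimately show "proj3_point (X, Y, Z, T) = proj3_point (X', Y', Z', T')" by blast
qed

text \<open>
  Jacobian criterion: at no point of the model are the gradients of the two defining forms linearly
  dependent.  Being stated for an arbitrary field, it applies over the algebraic closure.
\<close>

lemma edwards_nonsingular:
  fixes d X Y Z T a b :: "'a::field"
  assumes "(2 :: 'a) \<noteq> 0" "d \<noteq> 0" "d \<noteq> 1"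
    and curve: "X\<^sup>2 + Y\<^sup>2 = Z\<^sup>2 + d * T\<^sup>2" "X * Y = Z * T"
    and ab: "(a, b) \<noteq> (0, 0)"
    and dep: "a * (2 * X) + b * Y = 0" "a * (2 * Y) + b * X = 0"
      "a * (- 2 * Z) + b * (- T) = 0" "a * (- 2 * d * T) + b * (- Z) = 0"
  shows "(X, Y, Z, T) = (0, 0, 0, 0)"
proof (cases "a = 0")
  case True
  thus ?thesis using ab dep by simp
next
  case False
  define c where "c = - b / (2 * a)"
  have b: "b = - c * 2 * a" using False assms(1) by (simp add: c_def)
  have "a * 2 * (X - c * Y) = 0" "a * 2 * (Y - c * X) = 0" "a * 2 * (c * T - Z) = 0"
    "a * 2 * (c * Z - d * T) = 0"
    using dep unfolding b by (simp_all add: right_diff_distrib mult_ac)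
  hence e: "X = c * Y" "Y = c * X" "Z = c * T" "d * T = c * Z"
    using False assms(1) by simp_all
  have "c * (c * X) = X" "c * (c * Y) = Y" "c * (c * T) = d * T"
    by (simp_all only: e[symmetric])
  hence X: "(c\<^sup>2 - 1) * X = 0" "(c\<^sup>2 - 1) * Y = 0" "(c\<^sup>2 - d) * T = 0"
    by (simp_all only: left_diff_distrib power2_eq_square mult.assoc mult_1_left right_minus_eq)
  show ?thesis
  proof (cases "X = 0 \<and> Y = 0")
    case True
    hence "Z = 0 \<or> T = 0" using curve(2) by auto
    thus ?thesis using True assms(2) e(3,4) by auto
  next
    case False
    hence "c\<^sup>2 = 1" using X by auto
    hence "T = 0" using X(3) assms(3) by auto
    hence "Z = 0" using e(3) by simp
    have "X = 0 \<or> Y = 0" using curve(2) \<open>T = 0\<close> by simp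
    hence "X = 0 \<and> Y = 0" using e(1,2) by (metis mult_zero_right)
    thus ?thesis using \<open>T = 0\<close> \<open>Z = 0\<close> by simp
  qed
qed

lemma inj_edwards_affine_embedding:
  "inj_on (\<lambda>(x, y). proj3_point (x, y, 1, x * y)) (edwards_affine d)"
  by (auto simp: inj_on_def proj3_point_eq_iff)

lemma edwards_completed_eq:
  "edwards_completed d =
     (\<lambda>(x, y). proj3_point (x, y, 1, x * y)) ` edwards_affine d \<union>
     (\<lambda>s. proj3_point (s, 0, 0, 1)) ` {s. s\<^sup>2 = d} \<union>
     (\<lambda>s. proj3_point (0, s, 0, 1)) ` {s. s\<^sup>2 = d}"
  (is "_ = ?A \<union> ?B \<union> ?C")
proof
  show "?A \<union> ?B \<union> ?C \<subseteq> edwards_completed d"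
    by (auto simp: edwards_completed_def edwards_affine_def power_mult_distrib mult.assoc
        intro!: imageI)
next
  show "edwards_completed d \<subseteq> ?A \<union> ?B \<union> ?C"
  proof
    fix P assume "P \<in> edwards_completed d"
    then obtain X Y Z T where P: "P = proj3_point (X, Y, Z, T)"
      and nz: "(X, Y, Z, T) \<noteq> (0, 0, 0, 0)"
      and eq: "X\<^sup>2 + Y\<^sup>2 = Z\<^sup>2 + d * T\<^sup>2" "X * Y = Z * T"
      unfolding edwards_completed_def by auto
    show "P \<in> ?A \<union> ?B \<union> ?C"
    proof (cases "Z = 0")
      case False
      have T: "T = X * Y / Z" using eq(2) False by (simp add: field_simps)
      have "(X / Z)\<^sup>2 + (Y / Z)\<^sup>2 = (X\<^sup>2 + Y\<^sup>2) / Z\<^sup>2"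
        by (simp add: power_divide add_divide_distrib)
      also have "\<dots> = 1 + d * (T / Z)\<^sup>2"
        unfolding eq(1) using False by (simp add: power_divide add_divide_distrib)
      also have "\<dots> = 1 + d * (X / Z)\<^sup>2 * (Y / Z)\<^sup>2"
        unfolding T by (simp add: power_divide power_mult_distrib)
      finally have "(X / Z, Y / Z) \<in> edwards_affine d" by (simp add: edwards_affine_def)
      moreover have "P = proj3_point (X / Z, Y / Z, 1, X / Z * (Y / Z))"
        unfolding P proj3_point_eq_iff using False T by (intro exI[of _ "1 / Z"]) simp
      ultimately have "P \<in> ?A" by force
      thus ?thesis by blast
    next
      case True
      hence XY: "X = 0 \<or> Y = 0" using eq by simp
      have T: "T \<noteq> 0" using eq(1) XY nz True by auto
      show ?thesis
      proof (cases "Y = 0")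
        case True
        hence "(X / T)\<^sup>2 = d" using eq(1) T \<open>Z = 0\<close> by (simp add: power_divide)
        moreover have "P = proj3_point (X / T, 0, 0, 1)"
          unfolding P proj3_point_eq_iff using T \<open>Y = 0\<close> \<open>Z = 0\<close>
          by (intro exI[of _ "1 / T"]) simp
        ultimately show ?thesis by blast
      next
        case False
        hence "X = 0" using XY by simp
        hence "(Y / T)\<^sup>2 = d" using eq(1) T \<open>Z = 0\<close> by (simp add: power_divide)
        moreover have "P = proj3_point (0, Y / T, 0, 1)"
          unfolding P proj3_point_eq_iff using T \<open>X = 0\<close> \<open>Z = 0\<close>
          by (intro exI[of _ "1 / T"]) simp
        ultimately show ?thesis by blast
      qed
    qed
  qed
qed

lemma card_edwards_completed:
  fixes d :: "'a::{finite, field}"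
  assumes "d \<noteq> 0"
  shows "card (edwards_completed d) = card (edwards_affine d) + 2 * card {s. s\<^sup>2 = d}"
proof -
  let ?A = "(\<lambda>(x, y). proj3_point (x, y, 1, x * y)) ` edwards_affine d"
  let ?B = "(\<lambda>s. proj3_point (s, 0, 0, 1)) ` {s. s\<^sup>2 = d}"
  let ?C = "(\<lambda>s. proj3_point (0, s, 0, 1)) ` {s. s\<^sup>2 = d}"
  have "card ?A = card (edwards_affine d)"
    by (rule card_image[OF inj_edwards_affine_embedding])
  moreover have "card ?B = card {s. s\<^sup>2 = d}" "card ?C = card {s. s\<^sup>2 = d}"
    by (rule card_image, simp add: inj_on_def proj3_point_eq_iff)+
  moreover have "?A \<inter> (?B \<union> ?C) = {}" "?B \<inter> ?C = {}"
    using assms by (auto simp: proj3_point_eq_iff)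
  moreover have "edwards_completed d = ?A \<union> (?B \<union> ?C)"
    by (simp only: edwards_completed_eq Un_assoc)
  ultimately show ?thesis by (simp add: card_Un_disjoint)
qed

lemma card_edwards_completed_elliptic:
  fixes d :: "'a::{finite, field}"
  assumes two: "(2 :: 'a) \<noteq> 0" and d: "d \<noteq> 0" "d \<noteq> 1"
  shows "card (edwards_completed d) = card (edwards_elliptic_affine d) + 1"
proof -
  let ?S = "{s. s\<^sup>2 = d}"
  define A where "A = edwards_affine d - {(0, 1), (0, - 1)}"
  define B where "B = {(u, v) \<in> edwards_elliptic_affine d. u \<noteq> 1 \<and> v \<noteq> 0}"
  have ne: "(1 :: 'a) \<noteq> - 1" using two by (metis add.right_inverse one_add_one)
  have A': "x \<noteq> 0 \<and> y \<noteq> 1 \<and> y \<noteq> - 1" if "(x, y) \<in> A" for x y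
  proof -
    have eq: "x\<^sup>2 + y\<^sup>2 = 1 + d * x\<^sup>2 * y\<^sup>2" and n: "(x, y) \<noteq> (0, 1)" "(x, y) \<noteq> (0, - 1)"
      using that by (auto simp: A_def edwards_affine_def)
    have "x \<noteq> 0"
    proof
      assume "x = 0"
      hence "y\<^sup>2 = 1" using eq by simp
      thus False using n \<open>x = 0\<close> by (auto simp: power2_eq_1_iff)
    qed
    moreover have "y\<^sup>2 \<noteq> 1"
    proof
      assume "y\<^sup>2 = 1"
      hence "x\<^sup>2 * (1 - d) = 0" using eq by (simp add: algebra_simps)
      thus False using \<open>x \<noteq> 0\<close> d by simp
    qed
    ultimately show ?thesis by auto
  qed
  have A_eq: "(x, y) \<in> A \<longleftrightarrow> x\<^sup>2 + y\<^sup>2 = 1 + d * x\<^sup>2 * y\<^sup>2 \<and> x \<noteq> 0" for x y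
    using A'[of x y] by (auto simp: A_def edwards_affine_def)
  have "bij_betw (\<lambda>(x, y). ((y + 1) / (y - 1), 2 * ((y + 1) / (y - 1)) / x)) A B"
  proof (rule bij_betw_byWitness[where f' = "\<lambda>(u, v). (2 * u / v, (u + 1) / (u - 1))"])
    show "\<forall>a\<in>A. (\<lambda>(u, v). (2 * u / v, (u + 1) / (u - 1)))
        ((\<lambda>(x, y). ((y + 1) / (y - 1), 2 * ((y + 1) / (y - 1)) / x)) a) = a"
    proof
      fix a assume "a \<in> A"
      moreover obtain x y where a: "a = (x, y)" by (cases a)
      ultimately have h: "x \<noteq> 0" "y - 1 \<noteq> 0" "y + 1 \<noteq> 0" using A' by (auto simp: add_eq_0_iff2)
      define u where "u = (y + 1) / (y - 1)"
      have "u \<noteq> 0" using h by (simp add: u_def)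
      have "u + 1 = 2 * y / (y - 1)" "u - 1 = 2 / (y - 1)"
        using h by (simp_all add: u_def field_simps)
      hence "(u + 1) / (u - 1) = y" using h two by simp
      moreover have "2 * u / (2 * u / x) = x" using \<open>u \<noteq> 0\<close> h two by simp
      ultimately show "(\<lambda>(u, v). (2 * u / v, (u + 1) / (u - 1)))
          ((\<lambda>(x, y). ((y + 1) / (y - 1), 2 * ((y + 1) / (y - 1)) / x)) a) = a"
        unfolding a prod.case u_def[symmetric] by simp
    qed
  next
    show "\<forall>a\<in>B. (\<lambda>(x, y). ((y + 1) / (y - 1), 2 * ((y + 1) / (y - 1)) / x))
        ((\<lambda>(u, v). (2 * u / v, (u + 1) / (u - 1))) a) = a"
    proof
      fix b assume "b \<in> B"
      moreover obtain u v where b: "b = (u, v)" by (cases b)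
      ultimately have h: "u - 1 \<noteq> 0" "v \<noteq> 0" "u \<noteq> 0"
        by (auto simp: B_def edwards_elliptic_affine_def)
      define y where "y = (u + 1) / (u - 1)"
      have "y + 1 = 2 * u / (u - 1)" "y - 1 = 2 / (u - 1)"
        using h by (simp_all add: y_def field_simps)
      hence "(y + 1) / (y - 1) = u" using h two by simp
      moreover have "2 * u / (2 * u / v) = v" using h two by simp
      ultimately show "(\<lambda>(x, y). ((y + 1) / (y - 1), 2 * ((y + 1) / (y - 1)) / x))
          ((\<lambda>(u, v). (2 * u / v, (u + 1) / (u - 1))) b) = b"
        unfolding b prod.case y_def[symmetric] by simp
    qed
  next
    show "(\<lambda>(x, y). ((y + 1) / (y - 1), 2 * ((y + 1) / (y - 1)) / x)) ` A \<subseteq> B"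
    proof clarify
      fix x y assume xy: "(x, y) \<in> A"
      hence h: "x \<noteq> 0" "y - 1 \<noteq> 0" "y + 1 \<noteq> 0" using A' by (auto simp: add_eq_0_iff2)
      define u where "u = (y + 1) / (y - 1)"
      have u: "u \<noteq> 0" "u \<noteq> 1" using h two ne by (auto simp: u_def field_simps)
      have eq: "x\<^sup>2 * (1 - d * y\<^sup>2) = 1 - y\<^sup>2" using xy by (simp add: A_eq algebra_simps)
      have y: "y * (u - 1) = u + 1" using h by (simp add: u_def field_simps)
      have "x\<^sup>2 * ((u - 1)\<^sup>2 - d * (y * (u - 1))\<^sup>2) = (u - 1)\<^sup>2 - (y * (u - 1))\<^sup>2"
        using arg_cong[OF eq, of "\<lambda>t. t * (u - 1)\<^sup>2"]
        by (simp add: algebra_simps power2_eq_square)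
      hence W: "4 * u = x\<^sup>2 * (d * (u + 1)\<^sup>2 - (u - 1)\<^sup>2)"
        unfolding y by (simp add: algebra_simps power2_eq_square)
      have "(2 * u / x)\<^sup>2 = u * (4 * u) / x\<^sup>2"
        by (simp add: power_divide power2_eq_square)
      also have "\<dots> = u * (d * (u + 1)\<^sup>2 - (u - 1)\<^sup>2)"
        unfolding W using h by simp
      also have "\<dots> = (d - 1) * u ^ 3 + 2 * (d + 1) * u\<^sup>2 + (d - 1) * u"
        by (simp add: algebra_simps power2_eq_square power3_eq_cube)
      finally show "((y + 1) / (y - 1), 2 * ((y + 1) / (y - 1)) / x) \<in> B"
        using u h two by (simp add: B_def edwards_elliptic_affine_def u_def[symmetric])
    qed
  next
    show "(\<lambda>(u, v). (2 * u / v, (u + 1) / (u - 1))) ` B \<subseteq> A"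
    proof clarify
      fix u v assume uv: "(u, v) \<in> B"
      hence h: "u - 1 \<noteq> 0" "v \<noteq> 0" "u \<noteq> 0"
        by (auto simp: B_def edwards_elliptic_affine_def)
      define x where "x = 2 * u / v"
      define y where "y = (u + 1) / (u - 1)"
      have x: "x \<noteq> 0" using h two by (simp add: x_def)
      have xv: "x * v = 2 * u" using h by (simp add: x_def)
      have y: "y * (u - 1) = u + 1" using h by (simp add: y_def)
      have "v\<^sup>2 = u * (d * (u + 1)\<^sup>2 - (u - 1)\<^sup>2)"
        using uv by (simp add: B_def edwards_elliptic_affine_def algebra_simps
            power2_eq_square power3_eq_cube)
      hence "(x * v)\<^sup>2 = x\<^sup>2 * (u * (d * (u + 1)\<^sup>2 - (u - 1)\<^sup>2))"
        by (simp add: power_mult_distrib)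
      hence "u * (4 * u) = u * (x\<^sup>2 * (d * (u + 1)\<^sup>2 - (u - 1)\<^sup>2))"
        unfolding xv by (simp add: power2_eq_square algebra_simps)
      hence "x\<^sup>2 * (d * (u + 1)\<^sup>2 - (u - 1)\<^sup>2) = 4 * u" using h by simp
      hence "x\<^sup>2 * (d * (u + 1)\<^sup>2 - (u - 1)\<^sup>2) = (u + 1)\<^sup>2 - (u - 1)\<^sup>2"
        by (simp add: power2_eq_square algebra_simps)
      hence "(x\<^sup>2 * (d * y\<^sup>2 - 1)) * (u - 1)\<^sup>2 = (y\<^sup>2 - 1) * (u - 1)\<^sup>2"
        unfolding y[symmetric] by (simp add: algebra_simps power2_eq_square)
      hence "x\<^sup>2 * (d * y\<^sup>2 - 1) = y\<^sup>2 - 1" using h by simp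
      hence "(x, y) \<in> A" using x by (simp add: A_eq algebra_simps)
      thus "(2 * u / v, (u + 1) / (u - 1)) \<in> A" by (simp add: x_def y_def)
    qed
  qed
  hence AB: "card A = card B" by (rule bij_betw_same_card)
  have "edwards_affine d = A \<union> {(0, 1), (0, - 1)}"
    by (auto simp: A_def edwards_affine_def)
  moreover have "A \<inter> {(0, 1), (0, - 1)} = {}" by (auto simp: A_def)
  ultimately have cA: "card (edwards_affine d) = card A + 2"
    using ne by (simp add: card_Un_disjoint)
  have four: "(4 :: 'a) \<noteq> 0"
  proof -
    have "(4 :: 'a) = 2 * 2" by simp
    thus ?thesis using two by (metis mult_eq_0_iff)
  qed
  have e1: "(1, v) \<in> edwards_elliptic_affine d \<longleftrightarrow> v \<in> (\<lambda>s. 2 * s) ` ?S" for v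
  proof -
    have "(1, v) \<in> edwards_elliptic_affine d \<longleftrightarrow> v\<^sup>2 = 4 * d"
      by (simp add: edwards_elliptic_affine_def algebra_simps)
    also have "\<dots> \<longleftrightarrow> (v / 2)\<^sup>2 = d" using four by (simp add: power_divide field_simps)
    also have "\<dots> \<longleftrightarrow> v \<in> (\<lambda>s. 2 * s) ` ?S"
    proof
      assume "(v / 2)\<^sup>2 = d"
      moreover have "v = 2 * (v / 2)" using two by simp
      ultimately show "v \<in> (\<lambda>s. 2 * s) ` ?S" by blast
    qed (use two in auto)
    finally show ?thesis .
  qed
  define g where "g = (\<lambda>s. (2 * s - (d + 1)) / (d - 1))"
  have d1: "d - 1 \<noteq> 0" using d by simp
  have e2: "u \<noteq> 0 \<and> (u, 0) \<in> edwards_elliptic_affine d \<longleftrightarrow> u \<in> g ` ?S" for u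
  proof -
    have key: "4 * (((d - 1) * u + (d + 1)) / 2)\<^sup>2 = ((d - 1) * u + (d + 1))\<^sup>2"
      using four by (simp add: power_divide)
    have "(u, 0) \<in> edwards_elliptic_affine d \<longleftrightarrow>
        u * ((d - 1) * u\<^sup>2 + 2 * (d + 1) * u + (d - 1)) = 0"
      by (simp add: edwards_elliptic_affine_def algebra_simps power2_eq_square power3_eq_cube eq_commute)
    hence "u \<noteq> 0 \<and> (u, 0) \<in> edwards_elliptic_affine d \<longleftrightarrow>
        u \<noteq> 0 \<and> (d - 1) * ((d - 1) * u\<^sup>2 + 2 * (d + 1) * u + (d - 1)) = 0" using d1 by auto
    also have "(d - 1) * ((d - 1) * u\<^sup>2 + 2 * (d + 1) * u + (d - 1)) =
        ((d - 1) * u + (d + 1))\<^sup>2 - 4 * d"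
      by (simp add: algebra_simps power2_eq_square)
    also have "\<dots> = 4 * ((((d - 1) * u + (d + 1)) / 2)\<^sup>2 - d)"
      unfolding right_diff_distrib key ..
    also have "u \<noteq> 0 \<and> \<dots> = 0 \<longleftrightarrow> u \<noteq> 0 \<and> (((d - 1) * u + (d + 1)) / 2)\<^sup>2 = d"
      using four by simp
    also have "\<dots> \<longleftrightarrow> (((d - 1) * u + (d + 1)) / 2)\<^sup>2 = d"
    proof -
      have "((d - 1) * 0 + (d + 1))\<^sup>2 - 4 * d = (d - 1)\<^sup>2"
        by (simp add: algebra_simps power2_eq_square)
      hence "((d + 1) / 2)\<^sup>2 \<noteq> d" using d1 four by (auto simp: power_divide field_simps)
      thus ?thesis by auto
    qed
    also have "\<dots> \<longleftrightarrow> u \<in> g ` ?S"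
    proof
      assume "(((d - 1) * u + (d + 1)) / 2)\<^sup>2 = d"
      moreover have half: "2 * (t / 2) = t" for t :: 'a using two by simp
      have "u = g (((d - 1) * u + (d + 1)) / 2)" unfolding g_def half using d1 by simp
      ultimately show "u \<in> g ` ?S" by blast
    next
      assume "u \<in> g ` ?S"
      then obtain s where "s\<^sup>2 = d" "u = g s" by blast
      thus "(((d - 1) * u + (d + 1)) / 2)\<^sup>2 = d" using two d1 by (simp add: g_def)
    qed
    finally show ?thesis .
  qed
  have card4: "card (B' \<union> (U \<union> (V \<union> W))) = card B' + (card U + (card V + card W))"
    if "B' \<inter> (U \<union> (V \<union> W)) = {}" "U \<inter> (V \<union> W) = {}" "V \<inter> W = {}"
    for B' U V W :: "('a \<times> 'a) set"
    using that by (simp only: card_Un_disjoint finite)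
  let ?U = "(\<lambda>s. (1, 2 * s)) ` ?S" and ?V = "(\<lambda>s. (g s, 0)) ` ?S"
  have E: "edwards_elliptic_affine d = B \<union> (?U \<union> (?V \<union> {(0, 0)}))"
  proof -
    have "(u, v) \<in> edwards_elliptic_affine d \<longleftrightarrow> (u, v) \<in> B \<union> (?U \<union> (?V \<union> {(0, 0)}))" for u v
    proof -
      have "(u, v) \<in> ?U \<longleftrightarrow> u = 1 \<and> (1, v) \<in> edwards_elliptic_affine d" using e1[of v] by auto
      moreover have "(u, v) \<in> ?V \<longleftrightarrow> v = 0 \<and> u \<noteq> 0 \<and> (u, 0) \<in> edwards_elliptic_affine d"
        using e2[of u] by auto
      moreover have "(u, v) \<in> B \<longleftrightarrow> (u, v) \<in> edwards_elliptic_affine d \<and> u \<noteq> 1 \<and> v \<noteq> 0"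
        by (simp add: B_def)
      moreover have "(0, 0) \<in> edwards_elliptic_affine d"
        by (simp add: edwards_elliptic_affine_def)
      ultimately show ?thesis by auto
    qed
    thus ?thesis by auto
  qed
  have cU: "card ?U = card ?S" using two by (intro card_image) (auto simp: inj_on_def)
  have cV: "card ?V = card ?S" using two d1 by (intro card_image) (auto simp: inj_on_def g_def)
  have i1: "B \<inter> (?U \<union> (?V \<union> {(0, 0)})) = {}" by (auto simp: B_def)
  have i2: "?U \<inter> (?V \<union> {(0, 0)}) = {}" using two d by auto
  have i3: "?V \<inter> {(0, 0)} = {}" using e2 by auto
  have "card (edwards_elliptic_affine d) = card B + (card ?S + (card ?S + 1))"
    by (subst E, subst card4[OF i1 i2 i3]) (simp add: cU cV)
  thus ?thesis using card_edwards_completed[OF d(1)] AB cA by simp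
qed

end

theory Submission
  imports "HOL-Algebra.Algebraic_Closure_Type" Defs
begin

text \<open>
  All counts over the field with \<open>p^n\<close> elements are moved to the cubic
  \<open>v\<^sup>2 = f(u)\<close> and carried out inside an algebraic closure.  The \<open>L\<close>-function
  of the quadratic character along \<open>f\<close> has as its \<open>n\<close>-th coefficient the sum of
  \<open>chi (\<Prod> f(x))\<close> over the Frobenius-stable multisets of size \<open>n\<close>, i.e. over the
  root multisets of the monic polynomials of degree \<open>n\<close> over the prime field.  Splitting such
  multisets into Frobenius cycles gives Newton's identities between these coefficients and the
  character sums \<open>S\<^sub>n\<close> of \<open>f\<close>.  On the polynomial side the coefficients
  vanish from degree 3 on and the one in degree 2 is \<open>p\<close>, so the \<open>L\<close>-function is
  \<open>1 + S\<^sub>1 T + p T\<^sup>2\<close>.  Finally \<open>S\<^sub>1\<close> is congruent modulo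
  \<open>p\<close> to the given binomial sum up to sign and has absolute value less than \<open>p\<close>;
  hence \<open>S\<^sub>1 = 0\<close> and \<open>S\<^sub>n = - p S\<^bsub>n-2\<^esub>\<close> for \<open>n \<ge> 3\<close>.
\<close>

section \<open>Finite subfields of an algebraically closed field of odd characteristic\<close>

lemma card_roots_of_unity_le:
  assumes "k > 0"
  shows "finite {x :: 'b::idom. x ^ k = 1}" "card {x :: 'b. x ^ k = 1} \<le> k"
proof -
  let ?q = "monom 1 k - 1 :: 'b poly"
  have "coeff ?q k = 1" using assms by simp
  hence q: "?q \<noteq> 0" by (metis coeff_0 zero_neq_one)
  have eq: "{x. poly ?q x = 0} = {x. x ^ k = 1}" by (simp add: poly_monom)
  have "degree ?q \<le> k" by (intro degree_diff_le) (simp_all add: degree_monom_le)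
  thus "finite {x :: 'b. x ^ k = 1}" "card {x :: 'b. x ^ k = 1} \<le> k"
    using poly_roots_finite[OF q] card_poly_roots_bound[OF q] unfolding eq by simp_all
qed

locale odd_char =
  fixes p :: nat and K :: "'b::alg_closed_field itself"
  assumes prime_p: "prime p" and odd_p: "odd p" and char_p: "CHAR('b) = p"
begin

text \<open>
  The subfield with \<open>p ^ k\<close> elements; \<open>gf 0\<close> is the whole closure.
\<close>

definition gf :: "nat \<Rightarrow> 'b set" where
  "gf k = {x. x ^ (p ^ k) = x}"

definition half_p :: nat where "half_p = (p - 1) div 2"

text \<open>Euler's criterion turned into a definition. The values are integers, so that character
  sums live in characteristic 0. This is the quadratic character only on \<open>gf 1\<close>;
  elsewhere the value is a default.\<close>

definition chi :: "'b \<Rightarrow> int" where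
  "chi y = (if y = 0 then 0 else if y ^ half_p = 1 then 1 else - 1)"

lemma p_ge_3: "p \<ge> 3"
  using prime_p odd_p prime_ge_2_nat[of p] by (cases "p = 2") auto

lemma two_half_p: "2 * half_p = p - 1"
  using odd_p by (auto simp: half_p_def elim!: oddE)

lemma half_p_pos: "half_p > 0"
  using two_half_p p_ge_3 by linarith

lemma two_neq_0: "(2 :: 'b) \<noteq> 0"
proof
  assume "(2 :: 'b) = 0"
  hence "of_nat 2 = (0 :: 'b)" by simp
  hence "p dvd 2" unfolding of_nat_eq_0_iff_char_dvd char_p .
  thus False using p_ge_3 by (auto dest!: dvd_imp_le)
qed

lemma frob_add: "((x :: 'b) + y) ^ (p ^ k) = x ^ (p ^ k) + y ^ (p ^ k)"
  by (rule freshmans_dream') (simp_all add: char_p prime_p)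

lemma frob_minus: "(- (x :: 'b)) ^ (p ^ k) = - (x ^ (p ^ k))"
  using odd_p by simp

lemma frob_eq_iff: "(x :: 'b) ^ (p ^ k) = y ^ (p ^ k) \<longleftrightarrow> x = y"
proof
  assume "x ^ (p ^ k) = y ^ (p ^ k)"
  hence "(x + - y) ^ (p ^ k) = 0" unfolding frob_add frob_minus by simp
  thus "x = y" by simp
qed simp

lemma gf_0 [simp]: "0 \<in> gf k" and gf_1 [simp]: "1 \<in> gf k"
  using p_ge_3 by (auto simp: gf_def)

lemma gf_add [intro]: "x \<in> gf k \<Longrightarrow> y \<in> gf k \<Longrightarrow> x + y \<in> gf k"
  by (simp add: gf_def frob_add)

lemma gf_minus [intro]: "x \<in> gf k \<Longrightarrow> - x \<in> gf k"
  by (simp add: gf_def frob_minus)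

lemma gf_diff [intro]: "x \<in> gf k \<Longrightarrow> y \<in> gf k \<Longrightarrow> x - y \<in> gf k"
  using gf_add[of x k "- y"] gf_minus[of y k] by simp

lemma gf_mult [intro]: "x \<in> gf k \<Longrightarrow> y \<in> gf k \<Longrightarrow> x * y \<in> gf k"
  by (simp add: gf_def power_mult_distrib)

lemma gf_divide [intro]: "x \<in> gf k \<Longrightarrow> y \<in> gf k \<Longrightarrow> x / y \<in> gf k"
  by (simp add: gf_def power_divide)

lemma gf_power [intro]: "x \<in> gf k \<Longrightarrow> x ^ j \<in> gf k"
  by (induction j) auto

lemma gf_of_nat [simp]: "of_nat j \<in> gf k"
  by (induction j) auto

lemma gf_of_int [simp]: "of_int j \<in> gf k"
  by (cases j) (auto simp del: of_nat_Suc)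

lemma gf_numeral [simp]: "numeral j \<in> gf k"
  using gf_of_nat[of "numeral j" k] by simp

lemma gf_iterate: "x \<in> gf k \<Longrightarrow> x ^ (p ^ (k * j)) = x"
proof (induction j)
  case (Suc j)
  have "x ^ (p ^ (k * Suc j)) = (x ^ (p ^ (k * j))) ^ (p ^ k)"
    by (simp add: power_add power_mult[symmetric] mult_ac)
  thus ?case using Suc by (simp add: gf_def)
qed simp

lemma gf_1_subset: "gf 1 \<subseteq> gf k"
  using gf_iterate[of _ 1 k] by (auto simp: gf_def)

lemma gf_1D: "x \<in> gf 1 \<Longrightarrow> x ^ p ^ k = x"
  using gf_1_subset by (auto simp: gf_def)

text \<open>The elements are 0 and roots of unity of order dividing p^k - 1. An upper bound on the
  cardinality suffices: it is attained in \<open>gf 1\<close> by the images of 0, ..., p - 1, and in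
  \<open>gf n\<close> by an embedded field.\<close>

lemma finite_gf: "k > 0 \<Longrightarrow> finite (gf k)"
  and card_gf_le: "k > 0 \<Longrightarrow> card (gf k) \<le> p ^ k"
proof -
  assume "k > 0"
  hence gt: "p ^ k > 1" using p_ge_3 one_less_power[of p k] by linarith
  have "x ^ p ^ k = x \<longleftrightarrow> x = 0 \<or> x ^ (p ^ k - 1) = 1" for x :: 'b
  proof -
    have "x ^ p ^ k = x * x ^ (p ^ k - 1)"
      using gt by (metis Suc_pred' less_imp_Suc_add power_Suc zero_less_Suc)
    thus ?thesis using gt by auto
  qed
  hence eq: "gf k = insert 0 {x. x ^ (p ^ k - 1) = 1}" by (auto simp: gf_def)
  show "finite (gf k)" unfolding eq using card_roots_of_unity_le[of "p ^ k - 1", where 'b = 'b] gt by simp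
  have "card (gf k) \<le> Suc (card {x :: 'b. x ^ (p ^ k - 1) = 1})"
    unfolding eq by (rule card_insert_le_m1) auto
  also have "\<dots> \<le> p ^ k" using card_roots_of_unity_le[of "p ^ k - 1", where 'b = 'b] gt by simp
  finally show "card (gf k) \<le> p ^ k" .
qed

lemma of_nat_inj_p: "inj_on (of_nat :: nat \<Rightarrow> 'b) {..<p}"
  by (auto simp: inj_on_def of_nat_eq_iff_cong_CHAR char_p cong_def)

lemma card_gf_1: "card (gf 1) = p"
proof (rule antisym)
  show "card (gf 1) \<le> p" using card_gf_le[of 1] by simp
  have "p = card ((of_nat :: nat \<Rightarrow> 'b) ` {..<p})" using card_image[OF of_nat_inj_p] by simp
  also have "\<dots> \<le> card (gf 1)" by (intro card_mono finite_gf) auto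
  finally show "p \<le> card (gf 1)" .
qed

lemma gf_1_power: "x \<in> gf 1 \<Longrightarrow> x \<noteq> 0 \<Longrightarrow> x ^ (p - 1) = 1"
proof -
  assume x: "x \<in> gf 1" "x \<noteq> 0"
  have "x * x ^ (p - 1) = x ^ p" using p_ge_3 by (simp flip: power_Suc)
  also have "\<dots> = x * 1" using x by (simp add: gf_def)
  finally show ?thesis using x(2) by simp
qed

lemma of_int_eq_0_iff: "of_int a = (0 :: 'b) \<longleftrightarrow> int p dvd a"
  using of_int_eq_0_iff_char_dvd[of a, where 'a = 'b] by (simp add: char_p)

text \<open>The way back from characteristic p to the integers, for values of \<open>chi\<close> and
  at the end for \<open>charsum 1\<close>.\<close>

lemma of_int_eqD:
  assumes "of_int a = (of_int b :: 'b)" "\<bar>a - b\<bar> < int p"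
  shows "a = b"
proof -
  have "int p dvd a - b" using assms(1) of_int_eq_0_iff[of "a - b"] by simp
  thus ?thesis using assms(2) dvd_imp_le_int[of "a - b" "int p"] by auto
qed

section \<open>The quadratic character of the prime field\<close>

lemma chi_0 [simp]: "chi 0 = 0" and chi_1 [simp]: "chi 1 = 1"
  by (simp_all add: chi_def)

lemma chi_cases: "chi y \<in> {-1, 0, 1}"
  by (simp add: chi_def)

lemma abs_chi_le: "\<bar>chi y\<bar> \<le> 1"
  by (simp add: chi_def)

lemma of_int_chi:
  assumes "y \<in> gf 1"
  shows "of_int (chi y) = y ^ half_p"
proof (cases "y = 0")
  case False
  have "(y ^ half_p)\<^sup>2 = 1"
    using gf_1_power[OF assms False] by (simp only: two_half_p mult.commute[of half_p] flip: power_mult)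
  hence "y ^ half_p = 1 \<or> y ^ half_p = - 1" by (simp add: power2_eq_1_iff)
  thus ?thesis using False by (auto simp: chi_def)
qed (use half_p_pos in \<open>simp add: power_0_left\<close>)

text \<open>The two integers differ by at most 2, which is less than p; so identities between values
  of \<open>chi\<close> can be checked in the field.\<close>

lemma chi_eqI:
  assumes "y \<in> gf 1" "of_int a = y ^ half_p" "\<bar>a\<bar> \<le> 1"
  shows "chi y = a"
  using of_int_eqD[of "chi y" a] of_int_chi[OF assms(1)] assms abs_chi_le[of y] p_ge_3 by simp

lemma chi_mult:
  assumes "y \<in> gf 1" "z \<in> gf 1"
  shows "chi (y * z) = chi y * chi z"
  using assms chi_cases[of y] chi_cases[of z]
  by (intro chi_eqI) (auto simp: of_int_chi power_mult_distrib)

lemma chi_power: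
  assumes "y \<in> gf 1"
  shows "chi (y ^ k) = chi y ^ k"
  by (induction k) (simp_all add: chi_mult[OF assms gf_power[OF assms]])

lemma chi_square: "y \<noteq> 0 \<Longrightarrow> chi y * chi y = 1"
  by (simp add: chi_def)

lemma chi_square_mult:
  assumes "y \<in> gf 1" "z \<in> gf 1" "y \<noteq> 0"
  shows "chi (y\<^sup>2 * z) = chi z"
proof -
  have "chi (y\<^sup>2 * z) = chi y * chi y * chi z"
    using assms by (simp add: power2_eq_square chi_mult gf_mult)
  thus ?thesis using chi_square[OF assms(3)] by simp
qed

section \<open>Power sums and character sums over the prime field\<close>

lemma exists_power_neq_1:
  assumes "0 < k" "k < p - 1"
  obtains a where "a \<in> gf 1" "a \<noteq> 0" "a ^ k \<noteq> 1"
proof -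
  \<comment> \<open>Otherwise X^k - 1 would have p - 1 > k roots.\<close>
  have "\<not> gf 1 - {0} \<subseteq> {x. x ^ k = 1}"
  proof
    assume "gf 1 - {0} \<subseteq> {x. x ^ k = 1}"
    hence "card (gf 1 - {0}) \<le> k"
      using card_roots_of_unity_le[OF assms(1), where 'b = 'b] by (meson card_mono le_trans)
    thus False using assms card_gf_1 by (simp add: card_Diff_singleton)
  qed
  thus ?thesis using that by auto
qed

lemma sum_gf_1_scale:
  assumes "a \<in> gf 1" "a \<noteq> 0"
  shows "(\<Sum>t\<in>gf 1. g (a * t)) = (\<Sum>t\<in>gf 1. g t)"
  by (rule sum.reindex_bij_witness[of _ "\<lambda>t. t / a" "\<lambda>t. a * t"]) (use assms in auto)

lemma sum_gf_1_shift:
  assumes "a \<in> gf 1"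
  shows "(\<Sum>t\<in>gf 1. g (t + a)) = (\<Sum>t\<in>gf 1. g t)"
  by (rule sum.reindex_bij_witness[of _ "\<lambda>t. t - a" "\<lambda>t. t + a"]) (use assms in auto)

text \<open>Substituting a t for t, with a nonresidue a, reverses the sign.\<close>

lemma sum_chi: "(\<Sum>t\<in>gf 1. chi t) = 0"
proof -
  obtain a where a: "a \<in> gf 1" "a \<noteq> 0" "a ^ half_p \<noteq> 1"
    using exists_power_neq_1[of half_p] half_p_pos two_half_p by auto
  hence "chi a = - 1" by (simp add: chi_def)
  hence "(\<Sum>t\<in>gf 1. chi (a * t)) = - (\<Sum>t\<in>gf 1. chi t)"
    using a by (simp add: chi_mult sum_negf)
  thus ?thesis using sum_gf_1_scale[OF a(1,2), of chi] by simp
qed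

text \<open>For k = 0 the sum is p, which is 0 in the field. Otherwise substituting a t for t
  multiplies the sum by a^k, and a can be chosen with a^k different from 1.\<close>

lemma sum_power_eq_0:
  assumes "k < 2 * (p - 1)" "k \<noteq> p - 1"
  shows "(\<Sum>t\<in>gf 1. t ^ k) = 0"
proof (cases "k = 0")
  case True
  have "of_nat p = (0 :: 'b)" by (simp add: of_nat_eq_0_iff_char_dvd char_p)
  thus ?thesis using True card_gf_1 by simp
next
  case False
  \<comment> \<open>Below 2 (p - 1) one subtraction of p - 1 is enough. It does not change powers of
    nonzero elements of \<open>gf 1\<close>, and the result is positive because k is neither 0 nor p
    - 1.\<close>
  define k' where "k' = (if k < p - 1 then k else k - (p - 1))"
  have k': "0 < k'" "k' < p - 1" using assms False by (auto simp: k'_def)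
  obtain a where a: "a \<in> gf 1" "a \<noteq> 0" "a ^ k' \<noteq> 1" using exists_power_neq_1[OF k'] .
  have "a ^ k = a ^ k'"
  proof (cases "k < p - 1")
    case F: False
    hence "k = (p - 1) + k'" by (simp add: k'_def)
    thus ?thesis using gf_1_power[OF a(1,2)] by (simp only: power_add mult_1_left)
  qed (simp add: k'_def)
  hence ne: "a ^ k \<noteq> 1" using a(3) by simp
  have "(\<Sum>t\<in>gf 1. t ^ k) = (\<Sum>t\<in>gf 1. (a * t) ^ k)"
    using sum_gf_1_scale[OF a(1,2), of "\<lambda>t. t ^ k"] by simp
  also have "\<dots> = a ^ k * (\<Sum>t\<in>gf 1. t ^ k)"
    by (simp add: power_mult_distrib sum_distrib_left)
  finally have "(1 - a ^ k) * (\<Sum>t\<in>gf 1. t ^ k) = 0" by (simp add: algebra_simps)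
  thus ?thesis using ne by simp
qed

lemma sum_power_eq_minus_1:
  assumes "k > 0" "(p - 1) dvd k"
  shows "(\<Sum>t\<in>gf 1. t ^ k) = - 1"
proof -
  have "t ^ k = (if t = 0 then 0 else 1)" if "t \<in> gf 1" for t
    using gf_1_power[OF that] assms by (auto elim!: dvdE simp: power_mult power_0_left)
  hence "(\<Sum>t\<in>gf 1. t ^ k) = (\<Sum>t\<in>gf 1. if t = 0 then 0 else 1)" by (intro sum.cong) auto
  also have "\<dots> = (\<Sum>t\<in>gf 1 - {0}. 1)" by (intro sum.mono_neutral_cong_right finite_gf) auto
  also have "\<dots> = of_nat (p - 1)" using card_gf_1 by (simp add: card_Diff_singleton)
  also have "of_nat (p - 1) + 1 = (of_nat p :: 'b)" using p_ge_3
    by (metis Suc_eq_plus1 Suc_pred' of_nat_1 of_nat_add less_le_trans zero_less_numeral)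
  hence "of_nat (p - 1) = (- 1 :: 'b)"
    using of_nat_CHAR[where 'a = 'b] by (simp add: char_p eq_neg_iff_add_eq_0)
  finally show ?thesis .
qed

section \<open>Norms and square roots\<close>

text \<open>
  On \<open>gf k\<close> this is the norm down to the prime field.
\<close>

definition gnorm :: "nat \<Rightarrow> 'b \<Rightarrow> 'b" where
  "gnorm k y = (\<Prod>i<k. y ^ (p ^ i))"

lemma gnorm_gf_1: "y \<in> gf 1 \<Longrightarrow> gnorm k y = y ^ k"
  by (simp add: gnorm_def gf_1D)

text \<open>As p = 2 \<open>half_p\<close> + 1, each Frobenius step multiplies the current conjugate
  of w by the \<open>half_p\<close>-th power of its square, a conjugate of y; k steps collect the
  norm.\<close>

lemma square_root_frob:
  assumes "w\<^sup>2 = (y :: 'b)"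
  shows "w ^ (p ^ k) = w * gnorm k y ^ half_p"
proof (induction k)
  case (Suc k)
  have "w ^ (p ^ Suc k) = (w ^ (p ^ k)) ^ Suc (2 * half_p)"
    using p_ge_3 two_half_p by (simp add: mult.commute flip: power_mult)
  also have "\<dots> = w ^ (p ^ k) * ((w\<^sup>2) ^ (p ^ k)) ^ half_p"
    by (simp add: mult.commute mult.left_commute flip: power_mult)
  also have "\<dots> = w * (gnorm k y * y ^ (p ^ k)) ^ half_p"
    unfolding Suc.IH assms by (simp add: power_mult_distrib mult.assoc)
  finally show ?case by (simp add: gnorm_def)
qed (simp add: gnorm_def)

text \<open>A square root w taken in the closure lies in \<open>gf k\<close> iff the k-th Frobenius
  iterate fixes it, that is, iff the norm of y has \<open>half_p\<close>-th power 1.\<close>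

lemma card_square_roots:
  assumes "y \<in> gf k" "k > 0"
  shows "int (card {v \<in> gf k. v\<^sup>2 = y}) = 1 + chi (gnorm k y)"
proof -
  obtain w where w: "w\<^sup>2 = y" using nth_root_exists[of 2 y] by auto
  show ?thesis
  proof (cases "y = 0")
    case True
    hence "{v \<in> gf k. v\<^sup>2 = y} = {0}" by auto
    moreover have "gnorm k y = 0"
      using True p_ge_3 assms(2) by (auto simp: gnorm_def)
    ultimately show ?thesis by simp
  next
    case False
    hence w0: "w \<noteq> 0" "w \<noteq> - w" using w two_neq_0 by (auto simp: eq_neg_iff_add_eq_0 simp flip: mult_2)
    have N: "gnorm k y \<noteq> 0" using False by (simp add: gnorm_def)
    have iff: "w \<in> gf k \<longleftrightarrow> gnorm k y ^ half_p = 1"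
      using square_root_frob[OF w, of k] w0 by (simp add: gf_def)
    have sq: "v\<^sup>2 = y \<longleftrightarrow> v = w \<or> v = - w" for v
      using w by (metis power2_eq_iff)
    show ?thesis
    proof (cases "gnorm k y ^ half_p = 1")
      case True
      hence "{v \<in> gf k. v\<^sup>2 = y} = {w, - w}" using iff sq by auto
      thus ?thesis using True N w0 by (simp add: chi_def)
    next
      case False
      hence no: "{v \<in> gf k. v\<^sup>2 = y} = {}" using iff sq gf_minus[of "- w" k] by auto
      show ?thesis unfolding no using False N by (simp add: chi_def)
    qed
  qed
qed

end

section \<open>Frobenius-stable multisets and Frobenius cycles\<close>

lemma count_image_mset_of_inj: "inj g \<Longrightarrow> count (image_mset g D) (g x) = count D x"
  by (induction D) (auto simp: inj_eq)

context odd_char begin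

text \<open>These are the effective divisors of degree n on the affine line that are defined over
  the prime field.\<close>

definition stable :: "nat \<Rightarrow> 'b multiset set" where
  "stable n = {D. size D = n \<and> image_mset (\<lambda>x. x ^ p) D = D}"

text \<open>Indexed by exponents so that multiplicities count: if k is a proper multiple of the
  period of x, the orbit is repeated.\<close>

definition frob_cycle :: "nat \<Rightarrow> 'b \<Rightarrow> 'b multiset" where
  "frob_cycle k x = image_mset (\<lambda>i. x ^ (p ^ i)) (mset_set {..<k})"

lemma inj_frob: "inj (\<lambda>x :: 'b. x ^ p)"
  using frob_eq_iff[of _ 1] by (auto simp: inj_on_def)

lemma count_stable:
  assumes "D \<in> stable n"
  shows "count D (x ^ (p ^ i)) = count D x"
proof (induction i)
  case (Suc i)
  have "count D (x ^ (p ^ Suc i)) = count (image_mset (\<lambda>x. x ^ p) D) ((x ^ (p ^ i)) ^ p)"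
    using assms by (simp add: stable_def mult.commute flip: power_mult)
  also have "\<dots> = count D (x ^ (p ^ i))"
    by (rule count_image_mset_of_inj[OF inj_frob])
  finally show ?case using Suc by simp
qed simp

lemma size_frob_cycle [simp]: "size (frob_cycle k x) = k"
  by (simp add: frob_cycle_def)

lemma frob_cycle_stable:
  assumes "x \<in> gf k"
  shows "frob_cycle k x \<in> stable k"
proof -
  have "image_mset (\<lambda>x. x ^ p) (frob_cycle k x) = image_mset (\<lambda>i. x ^ (p ^ Suc i)) (mset_set {..<k})"
    by (simp add: frob_cycle_def multiset.map_comp o_def mult.commute flip: power_mult)
  also have "\<dots> = image_mset (\<lambda>i. x ^ (p ^ i)) (mset_set (Suc ` {..<k}))"
    by (subst image_mset_mset_set[symmetric]) (simp_all add: multiset.map_comp o_def)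
  \<comment> \<open>Frobenius moves the indices to 1, ..., k. Adding x supplies index 0 on one side;
    on the other, index k contributes x because x lies in \<open>gf k\<close>. So x cancels.\<close>
  also have "add_mset x \<dots> = image_mset (\<lambda>i. x ^ (p ^ i)) (mset_set {..<Suc k})"
    by (simp add: lessThan_Suc_eq_insert_0)
  also have "\<dots> = add_mset x (frob_cycle k x)"
    using assms by (simp add: lessThan_Suc frob_cycle_def gf_def)
  finally show ?thesis by (simp add: stable_def)
qed

text \<open>All Frobenius iterates of x lie in the finite support of D, so two of them coincide;
  injectivity of Frobenius cancels the smaller exponent.\<close>

lemma exists_period:
  assumes "D \<in> stable n" "x \<in># D"
  obtains k where "k > 0" "x \<in> gf k"
proof -
  have "x ^ (p ^ i) \<in># D" for i
    using count_stable[OF assms(1), of x i] assms(2) by (simp only: count_greater_zero_iff[symmetric])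
  hence "range (\<lambda>i. x ^ (p ^ i)) \<subseteq> set_mset D" by auto
  hence "finite (range (\<lambda>i. x ^ (p ^ i)))" using finite_subset finite_set_mset by blast
  hence "\<not> inj (\<lambda>i :: nat. x ^ (p ^ i))" using finite_imageD infinite_UNIV_nat by blast
  then obtain i j where ij: "i < j" "x ^ (p ^ i) = x ^ (p ^ j)"
    using linorder_injI[of "\<lambda>i :: nat. x ^ (p ^ i)"] by blast
  have "(x ^ (p ^ (j - i))) ^ (p ^ i) = x ^ (p ^ j)"
    using ij(1) by (simp flip: power_mult power_add)
  also note ij(2)[symmetric]
  finally have "x \<in> gf (j - i)" unfolding frob_eq_iff by (simp add: gf_def)
  thus ?thesis using that[of "j - i"] ij(1) by simp
qed

text \<open>
  If \<open>x\<close> has period \<open>r\<close>, then \<open>x \<in> gf k\<close> exactly for the multiples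
  \<open>k = r * j\<close>, and \<open>frob_cycle (r * j) x\<close> is the orbit of \<open>x\<close> taken
  \<open>j\<close> times.
\<close>

lemma card_cycles_in_stable:
  assumes D: "D \<in> stable n" and x: "x \<in># D"
  shows "card {k \<in> {1..n}. x \<in> gf k \<and> frob_cycle k x \<subseteq># D} = count D x"
proof -
  define r where "r = (LEAST k. k > 0 \<and> x \<in> gf k)"
  obtain k0 where "k0 > 0" "x \<in> gf k0" using exists_period[OF D x] .
  hence r: "r > 0" "x \<in> gf r"
    using LeastI[of "\<lambda>k. k > 0 \<and> x \<in> gf k" k0] by (simp_all add: r_def)
  have least: "\<not> (s > 0 \<and> x \<in> gf s)" if "s < r" for s
    using not_less_Least[of s "\<lambda>k. k > 0 \<and> x \<in> gf k"] that by (simp add: r_def)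
  have dvd: "x \<in> gf k \<longleftrightarrow> r dvd k" for k
  proof
    assume "x \<in> gf k"
    have "x ^ (p ^ k) = (x ^ (p ^ (r * (k div r)))) ^ (p ^ (k mod r))"
      by (simp flip: power_mult power_add)
    hence "x \<in> gf (k mod r)" using \<open>x \<in> gf k\<close> gf_iterate[OF r(2)] by (simp add: gf_def)
    thus "r dvd k" using least[of "k mod r"] r(1) by (auto simp: dvd_eq_mod_eq_0)
  next
    assume "r dvd k"
    thus "x \<in> gf k" using gf_iterate[OF r(2)] by (auto simp: gf_def)
  qed
  have inj: "inj_on (\<lambda>i. x ^ (p ^ i)) {..<r}"
  proof (rule linorder_inj_onI')
    fix i j assume ij: "i \<in> {..<r}" "j \<in> {..<r}" "i < j"
    have "x ^ (p ^ j) = (x ^ (p ^ (j - i))) ^ (p ^ i)"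
      using ij by (simp flip: power_mult power_add)
    moreover have "x \<notin> gf (j - i)" using least[of "j - i"] ij by auto
    ultimately show "x ^ (p ^ i) \<noteq> x ^ (p ^ j)" by (auto simp: gf_def frob_eq_iff)
  qed
  define orb where "orb = (\<lambda>i. x ^ (p ^ i)) ` {..<r}"
  have frob_cycle: "frob_cycle (r * j) x = repeat_mset j (mset_set orb)" for j
  proof (induction j)
    case (Suc j)
    \<comment> \<open>The first r indices run once through the orbit; in the others the shift by r
      has no effect, since x lies in \<open>gf r\<close>.\<close>
    have "{..<r * Suc j} = {..<r} \<union> (+) r ` {..<r * j}"
      by (auto simp: image_iff) (metis add_diff_inverse_nat lessThan_iff less_diff_conv2 linorder_not_less add.commute)
    moreover have "{..<r} \<inter> (+) r ` {..<r * j} = {}" by auto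
    ultimately have "mset_set {..<r * Suc j} = mset_set {..<r} + mset_set ((+) r ` {..<r * j})"
      by (simp add: mset_set_Union)
    also have "mset_set ((+) r ` {..<r * j}) = image_mset ((+) r) (mset_set {..<r * j})"
      by (rule image_mset_mset_set[symmetric]) simp
    finally have "frob_cycle (r * Suc j) x = frob_cycle r x + image_mset (\<lambda>i. x ^ (p ^ (r + i))) (mset_set {..<r * j})"
      by (simp add: frob_cycle_def multiset.map_comp o_def)
    also have "(\<lambda>i. x ^ (p ^ (r + i))) = (\<lambda>i. x ^ (p ^ i))"
      using r(2) by (simp add: gf_def power_add power_mult)
    also have "frob_cycle r x = mset_set orb"
      unfolding frob_cycle_def orb_def by (rule image_mset_mset_set[OF inj])
    finally show ?case using Suc.IH by (simp add: frob_cycle_def)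
  qed (simp add: frob_cycle_def)
  have fin: "finite orb" and x_orb: "x \<in> orb" using r(1) by (auto simp: orb_def intro!: image_eqI[of _ _ 0])
  \<comment> \<open>A point of the orbit occurs j times in the cycle, and in D as often as x
    does.\<close>
  have sub: "frob_cycle (r * j) x \<subseteq># D \<longleftrightarrow> j \<le> count D x" for j
  proof
    assume "frob_cycle (r * j) x \<subseteq># D"
    hence "count (frob_cycle (r * j) x) x \<le> count D x" by (simp add: mset_subset_eq_count)
    thus "j \<le> count D x" using fin x_orb by (simp add: frob_cycle)
  next
    assume "j \<le> count D x"
    moreover have "count D y = count D x" if "y \<in> orb" for y
      using that count_stable[OF D] by (auto simp: orb_def)
    ultimately show "frob_cycle (r * j) x \<subseteq># D"
      using fin by (intro mset_subset_eqI) (simp add: frob_cycle count_mset_set')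
  qed
  have "{k \<in> {1..n}. x \<in> gf k \<and> frob_cycle k x \<subseteq># D} = (\<lambda>j. r * j) ` {1..count D x}" (is "?L = ?R")
  proof
    show "?L \<subseteq> ?R"
    proof
      fix k assume k: "k \<in> ?L"
      then obtain j where j: "k = r * j" unfolding dvd by (auto elim: dvdE)
      hence "j \<in> {1..count D x}" using k sub[of j] by (cases j) simp_all
      thus "k \<in> ?R" using j by blast
    qed
    show "?R \<subseteq> ?L"
    proof clarify
      fix j assume j: "j \<in> {1..count D x}"
      hence s: "frob_cycle (r * j) x \<subseteq># D" using sub by simp
      hence "r * j \<le> n" using size_mset_mono[OF s] D by (simp add: stable_def)
      thus "r * j \<in> {1..n} \<and> x \<in> gf (r * j) \<and> frob_cycle (r * j) x \<subseteq># D" using s j r(1) by (simp add: dvd)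
    qed
  qed
  moreover have "inj_on (\<lambda>j. r * j) {1..count D x}" using r(1) by (simp add: inj_on_def)
  ultimately show ?thesis by (simp add: card_image)
qed

text \<open>Double counting of the pairs (x, k) whose cycle lies in D: a point of multiplicity m
  starts exactly m such cycles. This is the source of the factor n in Newton's identities.\<close>

lemma size_stable:
  assumes "D \<in> stable n"
  shows "n = (\<Sum>k=1..n. card {x \<in> gf k. frob_cycle k x \<subseteq># D})"
proof -
  have mem: "x \<in># D" if "k \<ge> 1" "frob_cycle k x \<subseteq># D" for k x
  proof -
    have "x \<in># frob_cycle k x" using that(1) by (auto simp: frob_cycle_def intro!: image_eqI[of _ _ 0])
    thus ?thesis using that(2) by (rule mset_subset_eqD[rotated])
  qed
  have "n = (\<Sum>x\<in>set_mset D. count D x)"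
    using assms by (simp add: stable_def size_multiset_overloaded_eq)
  also have "\<dots> = (\<Sum>x\<in>set_mset D. card {k \<in> {1..n}. x \<in> gf k \<and> frob_cycle k x \<subseteq># D})"
    using card_cycles_in_stable[OF assms] by simp
  also have "\<dots> = (\<Sum>x\<in>set_mset D. \<Sum>k=1..n. if x \<in> gf k \<and> frob_cycle k x \<subseteq># D then 1 else 0)"
    by (simp flip: sum.inter_filter)
  also have "\<dots> = (\<Sum>k=1..n. \<Sum>x\<in>set_mset D. if x \<in> gf k \<and> frob_cycle k x \<subseteq># D then 1 else 0)"
    by (rule sum.swap)
  also have "\<dots> = (\<Sum>k=1..n. card {x \<in> set_mset D. x \<in> gf k \<and> frob_cycle k x \<subseteq># D})"
    by (simp flip: sum.inter_filter)
  also have "\<dots> = (\<Sum>k=1..n. card {x \<in> gf k. frob_cycle k x \<subseteq># D})"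
    using mem by (intro sum.cong arg_cong[of _ _ card]) auto
  finally show ?thesis .
qed

section \<open>Monic polynomials and their root multisets\<close>

definition root_poly :: "'b multiset \<Rightarrow> 'b poly" where
  "root_poly D = (\<Prod>x\<in>#D. [:- x, 1:])"

definition monics :: "nat \<Rightarrow> 'b poly set" where
  "monics n = {g. degree g = n \<and> lead_coeff g = 1 \<and> (\<forall>i. coeff g i \<in> gf 1)}"

lemma root_poly_add [simp]: "root_poly (add_mset x D) = [:- x, 1:] * root_poly D"
  by (simp add: root_poly_def)

lemma monic_root_poly: "lead_coeff (root_poly D) = 1"
  by (induction D) (simp_all add: root_poly_def lead_coeff_mult del: mult_pCons_left)

lemma root_poly_neq_0 [simp]: "root_poly D \<noteq> 0"
  using monic_root_poly[of D] by (metis coeff_0 zero_neq_one)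

lemma degree_root_poly: "degree (root_poly D) = size D"
proof (induction D)
  case (add x D)
  show ?case using add by (simp only: root_poly_add) (subst degree_mult_eq, simp_all)
qed (simp add: root_poly_def)

lemma proots_root_poly: "proots (root_poly D) = D"
proof (induction D)
  case (add x D)
  show ?case using add by (simp only: root_poly_add) (subst proots_mult, simp_all)
qed (simp add: root_poly_def)

lemma frob_poly_mult:
  "map_poly (\<lambda>x :: 'b. x ^ p) (g * h) = map_poly (\<lambda>x. x ^ p) g * map_poly (\<lambda>x. x ^ p) h"
proof (rule poly_eqI)
  have z: "(0 :: 'b) ^ p = 0" using p_ge_3 by simp
  fix i show "coeff (map_poly (\<lambda>x. x ^ p) (g * h)) i =
      coeff (map_poly (\<lambda>x. x ^ p) g * map_poly (\<lambda>x. x ^ p) h) i"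
    by (simp add: coeff_map_poly z coeff_mult power_mult_distrib
        freshmans_dream_sum[OF _ char_p[symmetric]] char_p prime_p)
qed

lemma frob_root_poly:
  "map_poly (\<lambda>x. x ^ p) (root_poly D) = root_poly (image_mset (\<lambda>x. x ^ p) D)"
proof (induction D)
  case empty
  show ?case by (simp add: root_poly_def map_poly_1')
next
  case (add x D)
  have "map_poly (\<lambda>x. x ^ p) [:- x, 1:] = [:- (x ^ p), 1:]"
    using p_ge_3 odd_p by (simp add: map_poly_pCons)
  thus ?case using add by (simp only: root_poly_add frob_poly_mult image_mset_add_mset)
qed

text \<open>A monic polynomial and its root multiset determine each other, and Frobenius on the
  coefficients is Frobenius on the roots; so one is fixed iff the other is.\<close>

lemma bij_betw_root_poly: "bij_betw root_poly (stable n) (monics n)"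
proof (rule bij_betw_imageI)
  have z: "(0 :: 'b) ^ p = 0" using p_ge_3 by simp
  have fixed: "map_poly (\<lambda>x. x ^ p) g = g \<longleftrightarrow> (\<forall>i. coeff g i \<in> gf 1)" for g
    by (simp add: poly_eq_iff coeff_map_poly z gf_def)
  show "inj_on root_poly (stable n)"
    by (rule inj_on_inverseI[of _ proots]) (rule proots_root_poly)
  show "root_poly ` stable n = monics n"
  proof
    show "root_poly ` stable n \<subseteq> monics n"
    proof clarify
      fix D assume D: "D \<in> stable n"
      hence "map_poly (\<lambda>x. x ^ p) (root_poly D) = root_poly D"
        by (simp add: frob_root_poly stable_def)
      thus "root_poly D \<in> monics n"
        using D monic_root_poly[of D] by (simp add: monics_def degree_root_poly fixed stable_def)
    qed
    show "monics n \<subseteq> root_poly ` stable n"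
    proof
      fix g assume g: "g \<in> monics n"
      hence "g \<noteq> 0" by (auto simp: monics_def)
      then obtain D where D: "size D = degree g" "g = smult (lead_coeff g) (root_poly D)"
        using alg_closed_imp_factorization[of g] unfolding root_poly_def by blast
      moreover have "lead_coeff g = 1" using g by (auto simp: monics_def)
      ultimately have gD: "g = root_poly D" by simp
      hence "root_poly (image_mset (\<lambda>x. x ^ p) D) = root_poly D"
        using g fixed by (simp add: monics_def flip: frob_root_poly)
      hence "image_mset (\<lambda>x. x ^ p) D = D" by (metis proots_root_poly)
      thus "g \<in> root_poly ` stable n" using gD D(1) g by (auto simp: stable_def monics_def)
    qed
  qed
qed

lemma finite_monics: "finite (monics n)"
proof (rule finite_subset)
  show "monics n \<subseteq> Poly ` {xs. set xs \<subseteq> gf 1 \<and> length xs \<le> Suc n}"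
  proof
    fix g assume "g \<in> monics n"
    hence "set (coeffs g) \<subseteq> gf 1 \<and> length (coeffs g) \<le> Suc n"
      by (auto simp: monics_def coeffs_def)
    moreover have "g = Poly (coeffs g)" by simp
    ultimately show "g \<in> Poly ` {xs. set xs \<subseteq> gf 1 \<and> length xs \<le> Suc n}" by blast
  qed
qed (intro finite_imageI finite_lists_length_le finite_gf, simp)

lemma finite_stable: "finite (stable n)"
  using bij_betw_finite[OF bij_betw_root_poly] finite_monics by blast

end

section \<open>Newton's identities for a function commuting with Frobenius\<close>

locale frob_equivariant = odd_char p K for p and K :: "'b::alg_closed_field itself" +
  fixes f :: "'b \<Rightarrow> 'b"
  assumes f_frob: "f x ^ p = f (x ^ p)"
begin

definition weight :: "'b multiset \<Rightarrow> int" where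
  "weight D = chi (\<Prod>x\<in>#D. f x)"

definition L_coeff :: "nat \<Rightarrow> int" where
  "L_coeff n = (\<Sum>D\<in>stable n. weight D)"

text \<open>For k \<ge> 1, \<open>chi\<close> composed with the norm is the quadratic character of
  the field \<open>gf k\<close>.\<close>

definition charsum :: "nat \<Rightarrow> int" where
  "charsum k = (\<Sum>x\<in>gf k. chi (gnorm k (f x)))"

lemma f_frob_iterate: "f x ^ (p ^ k) = f (x ^ (p ^ k))"
proof (induction k)
  case (Suc k)
  have "f x ^ (p ^ Suc k) = (f x ^ (p ^ k)) ^ p" by (simp add: mult.commute flip: power_mult)
  also have "\<dots> = f ((x ^ (p ^ k)) ^ p)" by (simp only: Suc f_frob)
  finally show ?case by (simp add: mult.commute flip: power_mult)
qed simp

lemma prod_in_gf_1: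
  assumes "D \<in> stable n"
  shows "(\<Prod>x\<in>#D. f x) \<in> gf 1"
proof -
  have "(\<Prod>x\<in>#D. f x) ^ p = (\<Prod>x\<in>#image_mset (\<lambda>x. x ^ p) D. f x)"
    by (induction D) (simp_all add: power_mult_distrib f_frob)
  thus ?thesis using assms by (simp add: stable_def gf_def)
qed

lemma weight_add:
  assumes "D \<in> stable n" "E \<in> stable k"
  shows "weight (D + E) = weight D * weight E"
  using chi_mult[OF assms[THEN prod_in_gf_1]] by (simp add: weight_def)

text \<open>As f commutes with Frobenius, its values along the cycle are the conjugates of
  \<open>f x\<close>, and their product is the norm.\<close>

lemma weight_cycle: "weight (frob_cycle k x) = chi (gnorm k (f x))"
  by (simp add: weight_def frob_cycle_def gnorm_def f_frob_iterate multiset.map_comp o_def prod_unfold_prod_mset)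

text \<open>Removing the cycle is a bijection onto \<open>stable (n - k)\<close>, and the weight is
  multiplicative.\<close>

lemma sum_weight_above_cycle:
  assumes "x \<in> gf k" "k \<le> n"
  shows "(\<Sum>D | D \<in> stable n \<and> frob_cycle k x \<subseteq># D. weight D) = chi (gnorm k (f x)) * L_coeff (n - k)"
proof -
  have c: "frob_cycle k x \<in> stable k" by (rule frob_cycle_stable[OF assms(1)])
  have "(\<Sum>D | D \<in> stable n \<and> frob_cycle k x \<subseteq># D. weight D) = (\<Sum>D\<in>stable (n - k). weight (frob_cycle k x + D))"
  proof (rule sum.reindex_bij_witness[of _ "\<lambda>D. frob_cycle k x + D" "\<lambda>D. D - frob_cycle k x"])
    fix D assume D: "D \<in> {D. D \<in> stable n \<and> frob_cycle k x \<subseteq># D}"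
    then obtain E where E: "D = frob_cycle k x + E" by (metis mem_Collect_eq mset_subset_eq_exists_conv)
    thus "frob_cycle k x + (D - frob_cycle k x) = D" "D - frob_cycle k x \<in> stable (n - k)"
      "weight (frob_cycle k x + (D - frob_cycle k x)) = weight D"
      using D c by (auto simp: stable_def)
  next
    fix E assume "E \<in> stable (n - k)"
    thus "frob_cycle k x + E - frob_cycle k x = E" "frob_cycle k x + E \<in> {D. D \<in> stable n \<and> frob_cycle k x \<subseteq># D}"
      using c assms(2) by (auto simp: stable_def)
  qed
  also have "\<dots> = (\<Sum>D\<in>stable (n - k). weight (frob_cycle k x) * weight D)"
    by (intro sum.cong refl weight_add[OF c])
  finally show ?thesis by (simp add: weight_cycle L_coeff_def sum_distrib_left)
qed

text \<open>The factor n is replaced by the number of cycles contained in D; after exchanging the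
  sums, one sums over all D above a fixed cycle.\<close>

lemma L_coeff_recurrence: "int n * L_coeff n = (\<Sum>k=1..n. charsum k * L_coeff (n - k))"
proof -
  have "int n * L_coeff n = (\<Sum>D\<in>stable n. int n * weight D)"
    by (simp add: L_coeff_def sum_distrib_left)
  also have "\<dots> = (\<Sum>D\<in>stable n. \<Sum>k=1..n. int (card {x \<in> gf k. frob_cycle k x \<subseteq># D}) * weight D)"
  proof (intro sum.cong refl)
    fix D assume "D \<in> stable n"
    from arg_cong[OF size_stable[OF this], of "\<lambda>t. int t * weight D"]
    show "int n * weight D = (\<Sum>k=1..n. int (card {x \<in> gf k. frob_cycle k x \<subseteq># D}) * weight D)"
      unfolding of_nat_sum sum_distrib_right .
  qed
  also have "\<dots> = (\<Sum>D\<in>stable n. \<Sum>k=1..n. \<Sum>x\<in>gf k. if frob_cycle k x \<subseteq># D then weight D else 0)"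
    by (intro sum.cong refl) (simp add: finite_gf flip: sum.inter_filter)
  also have "\<dots> = (\<Sum>k=1..n. \<Sum>D\<in>stable n. \<Sum>x\<in>gf k. if frob_cycle k x \<subseteq># D then weight D else 0)"
    by (rule sum.swap)
  also have "\<dots> = (\<Sum>k=1..n. \<Sum>x\<in>gf k. \<Sum>D\<in>stable n. if frob_cycle k x \<subseteq># D then weight D else 0)"
    by (rule sum.cong[OF refl], rule sum.swap)
  also have "\<dots> = (\<Sum>k=1..n. \<Sum>x\<in>gf k. chi (gnorm k (f x)) * L_coeff (n - k))"
    by (intro sum.cong refl) (simp add: finite_stable sum_weight_above_cycle flip: sum.inter_filter)
  finally show ?thesis by (simp add: charsum_def sum_distrib_right)
qed

section \<open>Linear and quadratic character sums\<close>

lemma sum_chi_linear: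
  assumes "a \<in> gf 1" "a \<noteq> 0" "b \<in> gf 1"
  shows "(\<Sum>t\<in>gf 1. chi (a * t + b)) = 0"
  using sum_gf_1_scale[OF assms(1,2), of "\<lambda>t. chi (t + b)"]
    sum_gf_1_shift[OF assms(3), of chi] sum_chi by simp

text \<open>The hyperbola v^2 = t^2 - D is counted twice: over each t by the number of square roots,
  and through (t + v) (t - v) = D, where a = t + v runs over the p - 1 nonzero elements.\<close>

lemma sum_chi_square_minus:
  assumes "D \<in> gf 1" "D \<noteq> 0"
  shows "(\<Sum>t\<in>gf 1. chi (t\<^sup>2 - D)) = - 1"
proof -
  let ?X = "SIGMA t:gf 1. {v \<in> gf 1. v\<^sup>2 = t\<^sup>2 - D}"
  have fin: "finite (gf 1)" by (simp add: finite_gf)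
  have "int (card ?X) = (\<Sum>t\<in>gf 1. int (card {v \<in> gf 1. v\<^sup>2 = t\<^sup>2 - D}))"
    by (subst card_SigmaI) (use fin in auto)
  also have "\<dots> = (\<Sum>t\<in>gf 1. 1 + chi (t\<^sup>2 - D))"
    using assms(1) by (intro sum.cong refl, subst card_square_roots) (auto simp: gnorm_def)
  also have "\<dots> = int p + (\<Sum>t\<in>gf 1. chi (t\<^sup>2 - D))"
    using card_gf_1 by (simp add: sum.distrib)
  finally have X: "int (card ?X) = int p + (\<Sum>t\<in>gf 1. chi (t\<^sup>2 - D))" .
  have "bij_betw (\<lambda>a. ((a + D / a) / 2, (a - D / a) / 2)) (gf 1 - {0}) ?X"
  proof (rule bij_betw_byWitness[where f' = "\<lambda>(t, v). t + v"])
    show "\<forall>a\<in>gf 1 - {0}. (\<lambda>(t, v). t + v) ((a + D / a) / 2, (a - D / a) / 2) = a"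
      using two_neq_0 by (simp add: add_divide_distrib[symmetric])
    have *: "D / (t + v) = t - v \<and> t + v \<noteq> 0" if "v\<^sup>2 = t\<^sup>2 - D" for t v
    proof -
      have "D = (t + v) * (t - v)" using that by (simp add: algebra_simps power2_eq_square)
      thus ?thesis using assms(2) by auto
    qed
    show "\<forall>x\<in>?X. (\<lambda>a. ((a + D / a) / 2, (a - D / a) / 2)) ((\<lambda>(t, v). t + v) x) = x"
      using two_neq_0 * by auto
    show "(\<lambda>a. ((a + D / a) / 2, (a - D / a) / 2)) ` (gf 1 - {0}) \<subseteq> ?X"
    proof (rule image_subsetI)
      fix a assume "a \<in> gf 1 - {0}"
      hence a: "a \<in> gf 1" "a \<noteq> 0" by auto
      have e: "(a - D / a)\<^sup>2 = (a + D / a)\<^sup>2 - D * 2\<^sup>2"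
        using a by (simp add: field_simps power2_eq_square)
      have "D * 2\<^sup>2 / 2\<^sup>2 = D"
        by (rule nonzero_mult_div_cancel_right[OF power_not_zero[OF two_neq_0]])
      hence "((a - D / a) / 2)\<^sup>2 = ((a + D / a) / 2)\<^sup>2 - D"
        unfolding power_divide e diff_divide_distrib[of "(a + D / a)\<^sup>2"] by (rule arg_cong)
      moreover have "(a + D / a) / 2 \<in> gf 1" "(a - D / a) / 2 \<in> gf 1"
        using a assms(1) by (auto intro!: gf_divide gf_add gf_diff)
      ultimately show "((a + D / a) / 2, (a - D / a) / 2) \<in> ?X"
        by (intro SigmaI CollectI conjI)
    qed
    show "(\<lambda>(t, v). t + v) ` ?X \<subseteq> gf 1 - {0}"
    proof (rule image_subsetI)
      fix x assume "x \<in> ?X"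
      then obtain t v where "x = (t, v)" "t \<in> gf 1" "v \<in> gf 1" "v\<^sup>2 = t\<^sup>2 - D" by blast
      thus "(\<lambda>(t, v). t + v) x \<in> gf 1 - {0}" using *[of v t] gf_add[of t 1 v] by simp
    qed
  qed
  hence "card ?X = card (gf 1 - {0})" by (rule bij_betw_same_card[symmetric])
  also have "\<dots> = p - 1" using card_gf_1 by (simp add: card_Diff_singleton)
  finally have "int (card ?X) = int p - 1" using p_ge_3 by linarith
  thus ?thesis using X by linarith
qed

lemma poly_frob:
  assumes "g \<in> monics n"
  shows "poly g x ^ p = poly g (x ^ p)"
proof -
  have "coeff g i ^ p = coeff g i" for i using assms by (simp add: monics_def gf_def)
  hence "poly g x ^ p = (\<Sum>i\<le>degree g. coeff g i * (x ^ i) ^ p)"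
    by (simp add: poly_altdef freshmans_dream_sum[OF _ char_p[symmetric]] char_p prime_p power_mult_distrib)
  thus ?thesis by (simp add: poly_altdef mult.commute flip: power_mult)
qed

end

section \<open>The cubic of the Edwards curve and its roots\<close>

locale edwards_cubic = odd_char p K for p and K :: "'b::alg_closed_field itself" +
  fixes d :: 'b
  assumes d_in: "d \<in> gf 1" and d_neq: "d \<noteq> 0" "d \<noteq> 1"
begin

definition f :: "'b \<Rightarrow> 'b" where
  "f u = (d - 1) * u ^ 3 + 2 * (d + 1) * u\<^sup>2 + (d - 1) * u"

text \<open>Dividing the cubic by (d - 1) u leaves u^2 - \<open>root_sum\<close> u + 1. Its roots
  \<open>root1\<close> and \<open>root2\<close> need not lie in the prime field.\<close>

definition root_sum :: 'b where
  "root_sum = - (2 * (d + 1) / (d - 1))"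

definition root1 :: 'b where
  "root1 = (SOME x. x\<^sup>2 - root_sum * x + 1 = 0)"

definition root2 :: 'b where
  "root2 = root_sum - root1"

lemma root_sum_in: "root_sum \<in> gf 1"
  unfolding root_sum_def using d_in
  by (intro gf_minus gf_divide gf_mult gf_add gf_diff gf_numeral gf_1)

text \<open>The discriminant of the quadratic factor is nonzero: (\<open>root_sum\<close>^2 - 4) (d
  - 1)^2 = 16 d.\<close>

lemma root_sum_neq: "root_sum\<^sup>2 \<noteq> 4"
proof
  assume "root_sum\<^sup>2 = 4"
  hence "(root_sum * (d - 1))\<^sup>2 = 4 * (d - 1)\<^sup>2" by (simp add: power_mult_distrib)
  moreover have "root_sum * (d - 1) = - (2 * (d + 1))" using d_neq by (simp add: root_sum_def)
  moreover have "(- (2 * (d + 1)))\<^sup>2 - 4 * (d - 1)\<^sup>2 = 2 * (2 * (2 * (2 * d)))"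
    by (simp add: algebra_simps power2_eq_square)
  ultimately have "2 * (2 * (2 * (2 * d))) = 0" by simp
  thus False using two_neq_0 d_neq by (simp only: mult_eq_0_iff) simp
qed

lemma root1_root: "root1\<^sup>2 = root_sum * root1 - 1"
proof -
  have "\<exists>x. poly [:1, - root_sum, 1:] x = 0" by (rule alg_closed_imp_poly_has_root) simp
  hence "\<exists>x. x\<^sup>2 - root_sum * x + 1 = 0" by (simp add: algebra_simps power2_eq_square)
  hence "root1\<^sup>2 - root_sum * root1 + 1 = 0" unfolding root1_def by (rule someI_ex)
  thus ?thesis by (simp add: algebra_simps)
qed

lemma roots_sum_prod: "root1 * root2 = 1" "root1 + root2 = root_sum"
  using root1_root by (simp_all add: root2_def algebra_simps power2_eq_square)

lemma quadratic_factored: "u\<^sup>2 - root_sum * u + 1 = (u - root1) * (u - root2)"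
proof -
  have "(u - root1) * (u - root2) = u\<^sup>2 - (root1 + root2) * u + root1 * root2"
    by (simp add: algebra_simps power2_eq_square)
  thus ?thesis by (simp add: roots_sum_prod)
qed

lemma f_factored: "f u = (d - 1) * u * ((u - root1) * (u - root2))"
proof -
  have key: "(d - 1) * root_sum = - (2 * (d + 1))" using d_neq by (simp add: root_sum_def)
  have "(d - 1) * u * (u\<^sup>2 - root_sum * u + 1) = (d - 1) * u ^ 3 - (d - 1) * root_sum * u\<^sup>2 + (d - 1) * u"
    by (simp add: algebra_simps power2_eq_square power3_eq_cube)
  hence "(d - 1) * u * (u\<^sup>2 - root_sum * u + 1) = f u"
    by (simp only: key f_def mult_minus_left diff_minus_eq_add)
  thus ?thesis by (simp add: quadratic_factored)
qed

sublocale frob_equivariant p K f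
proof
  fix x
  have "d - 1 \<in> gf 1" using d_in by (intro gf_diff gf_1)
  moreover have "2 * (d + 1) \<in> gf 1" using d_in by (intro gf_mult gf_add gf_numeral gf_1)
  ultimately have c: "(d - 1) ^ p = d - 1" "(2 * (d + 1)) ^ p = 2 * (d + 1)" by (simp_all only: gf_def mem_Collect_eq power_one_right)
  have "(a + b) ^ p = a ^ p + b ^ p" for a b :: 'b using frob_add[of a b 1] by simp
  thus "f x ^ p = f (x ^ p)"
    by (simp only: f_def power_mult_distrib[of "d - 1"] power_mult_distrib[of "2 * (d + 1)"] c
        mult.commute[of p] flip: power_mult)
qed

text \<open>Frobenius fixes the coefficients of the quadratic, hence permutes its roots;
  \<open>root2\<close> follows \<open>root1\<close> because their sum is fixed.\<close>

lemma frob_roots: "(root1 ^ p = root1 \<and> root2 ^ p = root2) \<or> (root1 ^ p = root2 \<and> root2 ^ p = root1)"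
proof -
  have fr: "(a + b) ^ p = a ^ p + b ^ p" for a b :: 'b using frob_add[of a b 1] by simp
  have root_sum: "root_sum ^ p = root_sum" using root_sum_in by (simp add: gf_def)
  have sum: "root1 ^ p + root2 ^ p = root_sum" using fr[of root1 root2] by (simp add: roots_sum_prod root_sum)
  have "root1 ^ p * root2 ^ p = 1" by (simp add: roots_sum_prod flip: power_mult_distrib)
  hence "(root1 ^ p - root1) * (root1 ^ p - root2) = root1 ^ p * (root1 ^ p + root2 ^ p - (root1 + root2))"
    unfolding quadratic_factored[symmetric] sum roots_sum_prod
    by (simp add: algebra_simps power2_eq_square flip: sum)
  hence "root1 ^ p = root1 \<or> root1 ^ p = root2" by (simp add: sum roots_sum_prod)
  moreover have "root2 ^ p = root_sum - root1 ^ p" "root2 = root_sum - root1" "root1 = root_sum - root2"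
    using sum roots_sum_prod(2) by (auto simp: algebra_simps)
  ultimately show ?thesis by metis
qed

text \<open>The resultant of the quadratic factor with g. Being symmetric in the two roots, it lies
  in the prime field for g over the prime field, even when the roots are conjugate.\<close>

definition root_value :: "'b poly \<Rightarrow> 'b" where
  "root_value g = poly g root1 * poly g root2"

lemma root_value_in:
  assumes "g \<in> monics n"
  shows "root_value g \<in> gf 1"
  using frob_roots by (auto simp: root_value_def gf_def power_mult_distrib poly_frob[OF assms])

lemma poly_0_in: "g \<in> monics n \<Longrightarrow> poly g 0 \<in> gf 1"
  by (simp add: monics_def poly_0_coeff_0)

text \<open>Symmetry of the resultant: the product of f over the roots of g is, up to a constant,
  the product of g over the roots 0, \<open>root1\<close>, \<open>root2\<close> of f. The three sign
  changes turn d - 1 into 1 - d.\<close>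

lemma prod_f_eq:
  "(\<Prod>x\<in>#D. f x) = (1 - d) ^ size D * (poly (root_poly D) 0 * root_value (root_poly D))"
proof (induction D)
  case (add x D)
  have "f x = (1 - d) * ((0 - x) * ((root1 - x) * (root2 - x)))"
    unfolding f_factored by (simp add: algebra_simps)
  moreover have "poly (root_poly (add_mset x D)) z = (z - x) * poly (root_poly D) z" for z
    by (simp add: algebra_simps)
  ultimately show ?case using add
    by (simp only: root_value_def image_mset_add_mset prod_mset.add_mset size_add_mset power_Suc mult_ac)
qed (simp add: root_poly_def root_value_def)

section \<open>The coefficients of the L-function\<close>

lemma L_coeff_eq:
  "L_coeff n = (\<Sum>g\<in>monics n. chi ((1 - d) ^ n * (poly g 0 * root_value g)))"
proof -
  have "L_coeff n = (\<Sum>D\<in>stable n. chi ((1 - d) ^ n * (poly (root_poly D) 0 * root_value (root_poly D))))"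
    by (simp add: L_coeff_def weight_def prod_f_eq stable_def)
  also have "\<dots> = (\<Sum>g\<in>monics n. chi ((1 - d) ^ n * (poly g 0 * root_value g)))"
    by (rule sum.reindex_bij_betw[OF bij_betw_root_poly])
  finally show ?thesis .
qed

lemma L_coeff_0: "L_coeff 0 = 1"
proof -
  have "stable 0 = {{#}}" by (auto simp: stable_def)
  thus ?thesis by (simp add: L_coeff_def weight_def)
qed

text \<open>
  Adding \<open>t\<close> times the quadratic factor of \<open>f\<close> permutes the monic polynomials of
  degree \<open>n \<ge> 3\<close> and changes only the value at the third root \<open>0\<close>; averaging over
  \<open>t\<close> leaves a full character sum.
\<close>

lemma L_coeff_ge_3:
  assumes "n \<ge> 3"
  shows "L_coeff n = 0"
proof -
  define h where "h = [:1, - root_sum, 1:]"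
  have deg_h: "degree h = 2" by (simp add: h_def)
  have h: "poly h root1 = 0" "poly h root2 = 0" "poly h 0 = 1"
    using quadratic_factored[of root1] quadratic_factored[of root2]
    by (simp_all add: h_def algebra_simps power2_eq_square)
  have coeff_h: "coeff h i \<in> gf 1" for i
    using root_sum_in by (auto simp: h_def coeff_pCons split: nat.splits)
  define G where "G = (\<lambda>g. chi ((1 - d) ^ n * (poly g 0 * root_value g)))"
  \<comment> \<open>Here n \<ge> 3 matters: a multiple of the quadratic \<open>h\<close> affects
    neither the degree nor the leading coefficient.\<close>
  have mon: "g + smult t h \<in> monics n" if "g \<in> monics n" "t \<in> gf 1" for g t
  proof -
    have "degree (smult t h) < degree g" using that(1) assms deg_h degree_smult_le[of t h]
      by (simp add: monics_def)
    moreover have "coeff h n = 0" using assms deg_h by (intro coeff_eq_0) simp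
    ultimately have "degree (g + smult t h) = n" "lead_coeff (g + smult t h) = 1"
      using that(1) by (auto simp: monics_def degree_add_eq_left)
    moreover have "coeff (g + smult t h) i \<in> gf 1" for i
      using that coeff_h by (auto simp: monics_def)
    ultimately show ?thesis by (simp add: monics_def)
  qed
  have shift: "(\<Sum>g\<in>monics n. G (g + smult t h)) = (\<Sum>g\<in>monics n. G g)" if "t \<in> gf 1" for t
    by (rule sum.reindex_bij_witness[of _ "\<lambda>g. g + smult (- t) h" "\<lambda>g. g + smult t h"])
      (erule mon[OF _ that] mon[OF _ gf_minus[OF that]] | simp)+
  have "int p * L_coeff n = (\<Sum>t\<in>gf 1. \<Sum>g\<in>monics n. G g)"
    using card_gf_1 by (simp add: L_coeff_eq G_def)
  also have "\<dots> = (\<Sum>t\<in>gf 1. \<Sum>g\<in>monics n. G (g + smult t h))"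
    by (rule sum.cong[OF refl], rule shift[symmetric])
  also have "\<dots> = (\<Sum>g\<in>monics n. \<Sum>t\<in>gf 1. G (g + smult t h))" by (rule sum.swap)
  also have "\<dots> = 0"
  proof (rule sum.neutral, rule ballI)
    fix g assume g: "g \<in> monics n"
    \<comment> \<open>The slope in t of the argument of \<open>chi\<close>, as \<open>h\<close> is 1
      at 0 and vanishes at the other two roots.\<close>
    define a where "a = (1 - d) ^ n * root_value g"
    have a: "a \<in> gf 1" unfolding a_def using root_value_in[OF g] d_in by (auto intro!: gf_mult gf_power gf_diff)
    have G: "G (g + smult t h) = chi (a * t + a * poly g 0)" for t
      by (simp add: G_def a_def root_value_def h algebra_simps)
    show "(\<Sum>t\<in>gf 1. G (g + smult t h)) = 0"
    proof (cases "a = 0")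
      case False
      show ?thesis unfolding G using a g False by (intro sum_chi_linear gf_mult poly_0_in)
    qed (simp add: G)
  qed
  finally show ?thesis using p_ge_3 by simp
qed

text \<open>
  Written as \<open>(X - root1) (X - root2) + a X + b\<close>, a monic quadratic contributes the character
  of \<open>1 + b\<close> times that of a quadratic form in \<open>(a, b)\<close> of nonzero discriminant.
\<close>

lemma L_coeff_2: "L_coeff 2 = int p"
proof -
  have fin: "finite (gf 1)" by (simp add: finite_gf)
  define G where "G = (\<lambda>g. chi ((1 - d)\<^sup>2 * (poly g 0 * root_value g)))"
  have G: "G [:1 + b, a - root_sum, 1:] = chi (1 + b) * chi ((a + root_sum / 2 * b)\<^sup>2 - b\<^sup>2 * ((root_sum / 2)\<^sup>2 - 1))"
    if "a \<in> gf 1" "b \<in> gf 1" for a b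
  proof -
    have ev: "poly [:1 + b, a - root_sum, 1:] u = (u - root1) * (u - root2) + (a * u + b)" for u
      unfolding quadratic_factored[symmetric] by (simp add: algebra_simps power2_eq_square)
    have "root_value [:1 + b, a - root_sum, 1:] = a\<^sup>2 * (root1 * root2) + a * b * (root1 + root2) + b\<^sup>2"
      unfolding root_value_def ev by (simp add: algebra_simps power2_eq_square)
    also have "\<dots> = a\<^sup>2 + a * b * (2 * (root_sum / 2)) + b\<^sup>2"
      using two_neq_0 by (simp add: roots_sum_prod)
    \<comment> \<open>Completing the square in a; the coefficient of b^2 that remains is a quarter
      of the discriminant.\<close>
    also have "\<dots> = (a + root_sum / 2 * b)\<^sup>2 - b\<^sup>2 * ((root_sum / 2)\<^sup>2 - 1)"
      unfolding distrib_left mult_2 by (simp only: algebra_simps power2_eq_square mult_2) simp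
    finally have root_value: "root_value [:1 + b, a - root_sum, 1:] = (a + root_sum / 2 * b)\<^sup>2 - b\<^sup>2 * ((root_sum / 2)\<^sup>2 - 1)" .
    have "(a + root_sum / 2 * b)\<^sup>2 - b\<^sup>2 * ((root_sum / 2)\<^sup>2 - 1) \<in> gf 1"
      using that root_sum_in by (intro gf_diff gf_mult gf_power gf_add gf_divide) auto
    moreover have "1 + b \<in> gf 1" "1 - d \<in> gf 1" "1 - d \<noteq> 0" using that d_in d_neq by auto
    \<comment> \<open>The nonzero square (1 - d)^2 drops out of the character.\<close>
    ultimately show ?thesis
      unfolding G_def root_value by (simp add: chi_square_mult gf_mult chi_mult)
  qed
  have "L_coeff 2 = (\<Sum>g\<in>monics 2. G g)" by (simp add: L_coeff_eq G_def)
  also have "\<dots> = (\<Sum>(b, a)\<in>gf 1 \<times> gf 1. G [:1 + b, a - root_sum, 1:])"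
  proof (rule sum.reindex_bij_witness[of _ "\<lambda>(b, a). [:1 + b, a - root_sum, 1:]"
        "\<lambda>g. (coeff g 0 - 1, coeff g 1 + root_sum)"])
    fix g assume g: "g \<in> monics 2"
    hence "g = [:coeff g 0, coeff g 1, 1:]"
      by (intro poly_eqI) (auto simp: monics_def coeff_pCons numeral_2_eq_2 coeff_eq_0 split: nat.splits)
    thus "(\<lambda>(b, a). [:1 + b, a - root_sum, 1:]) (coeff g 0 - 1, coeff g 1 + root_sum) = g" by simp
    thus "(case (coeff g 0 - 1, coeff g 1 + root_sum) of (b, a) \<Rightarrow> G [:1 + b, a - root_sum, 1:]) = G g" by simp
    show "(coeff g 0 - 1, coeff g 1 + root_sum) \<in> gf 1 \<times> gf 1"
      using g root_sum_in by (auto simp: monics_def)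
  next
    fix x assume x: "x \<in> gf 1 \<times> gf 1"
    obtain b a where xba: "x = (b, a)" by (cases x)
    have "coeff [:1 + b, a - root_sum, 1:] i \<in> gf 1" for i
      using x root_sum_in unfolding xba by (auto simp: coeff_pCons split: nat.splits)
    thus "(\<lambda>(b, a). [:1 + b, a - root_sum, 1:]) x \<in> monics 2" unfolding xba by (simp add: monics_def)
    show "(coeff ((\<lambda>(b, a). [:1 + b, a - root_sum, 1:]) x) 0 - 1, coeff ((\<lambda>(b, a). [:1 + b, a - root_sum, 1:]) x) 1 + root_sum) = x"
      unfolding xba by simp
  qed
  also have "\<dots> = (\<Sum>b\<in>gf 1. \<Sum>a\<in>gf 1. G [:1 + b, a - root_sum, 1:])"
    by (rule sum.cartesian_product[symmetric])
  also have "\<dots> = (\<Sum>b\<in>gf 1. chi (1 + b) * (if b = 0 then int p - 1 else - 1))"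
  proof (intro sum.cong refl)
    fix b assume b: "b \<in> gf 1"
    define D where "D = b\<^sup>2 * ((root_sum / 2)\<^sup>2 - 1)"
    have D: "D \<in> gf 1" using b root_sum_in unfolding D_def
      by (intro gf_diff gf_mult gf_power gf_divide) auto
    have sb: "root_sum / 2 * b \<in> gf 1" using b root_sum_in by (intro gf_mult gf_divide) auto
    have "(\<Sum>a\<in>gf 1. G [:1 + b, a - root_sum, 1:]) = chi (1 + b) * (\<Sum>a\<in>gf 1. chi ((a + root_sum / 2 * b)\<^sup>2 - D))"
      using b by (simp add: G D_def sum_distrib_left)
    also have "(\<Sum>a\<in>gf 1. chi ((a + root_sum / 2 * b)\<^sup>2 - D)) = (\<Sum>a\<in>gf 1. chi (a\<^sup>2 - D))"
      by (rule sum_gf_1_shift[OF sb])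
    \<comment> \<open>For b = 0 the form is a^2, nonzero at p - 1 places; otherwise D is nonzero and
      the hyperbola count applies.\<close>
    also have "\<dots> = (if b = 0 then int p - 1 else - 1)"
    proof (cases "b = 0")
      case True
      have "chi (a\<^sup>2 - D) = (if a = 0 then 0 else 1)" if "a \<in> gf 1" for a
        using True that chi_square_mult[of a 1] by (simp add: D_def)
      hence "(\<Sum>a\<in>gf 1. chi (a\<^sup>2 - D)) = (\<Sum>a\<in>gf 1. if a = 0 then 0 else 1)" by (rule sum.cong[OF refl])
      also have "\<dots> = (\<Sum>a\<in>gf 1 - {0}. 1)" by (intro sum.mono_neutral_cong_right fin) auto
      finally show ?thesis using True card_gf_1 p_ge_3 by (simp add: card_Diff_singleton of_nat_diff)
    next
      case False
      have "root_sum\<^sup>2 = 2\<^sup>2 * (root_sum / 2)\<^sup>2" using two_neq_0 by (simp only: power_mult_distrib[symmetric]) simp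
      hence "(root_sum / 2)\<^sup>2 \<noteq> 1" using root_sum_neq by auto
      hence "D \<noteq> 0" using False by (simp add: D_def)
      thus ?thesis using sum_chi_square_minus[OF D] False by simp
    qed
    finally show "(\<Sum>a\<in>gf 1. G [:1 + b, a - root_sum, 1:]) = chi (1 + b) * (if b = 0 then int p - 1 else - 1)" .
  qed
  \<comment> \<open>As \<open>chi 1\<close> is 1, the summand at b = 0 is p - \<open>chi 1\<close>,
    so a full sum of \<open>chi\<close> splits off.\<close>
  also have "\<dots> = (\<Sum>b\<in>gf 1. (if b = 0 then int p else 0) - chi (b + 1))"
    by (intro sum.cong refl) (simp add: add.commute algebra_simps)
  also have "\<dots> = int p - (\<Sum>b\<in>gf 1. chi (b + 1))"
    using fin by (simp add: sum_subtractf)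
  also have "(\<Sum>b\<in>gf 1. chi (b + 1)) = 0" using sum_gf_1_shift[of 1 chi] sum_chi by simp
  finally show ?thesis by simp
qed

lemma L_coeff_1: "L_coeff 1 = charsum 1"
  using L_coeff_recurrence[of 1] L_coeff_0 by simp

text \<open>The coefficient of index 1 is \<open>charsum 1\<close>, so only those of index 0 and 2
  survive, with values 1 and p. For n \<ge> 3 the recurrence becomes
  \<open>charsum n = - int p * charsum (n - 2)\<close>, with initial values 0 and 2 p.\<close>

lemma charsum_eq:
  assumes "charsum 1 = 0" "n \<ge> 1"
  shows "charsum n = (if odd n then 0 else - 2 * (- int p) ^ (n div 2))"
  using assms(2)
proof (induction n rule: less_induct)
  case (less n)
  consider "n = 1" | "n = 2" | "n \<ge> 3" using less.prems by linarith
  thus ?case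
  proof cases
    case 1
    thus ?thesis using assms(1) by simp
  next
    case 2
    have "{1..2 :: nat} = {1, 2}" by auto
    hence "charsum 2 = 2 * int p"
      using L_coeff_recurrence[of 2] L_coeff_2 L_coeff_1 L_coeff_0 assms(1) by simp
    thus ?thesis using 2 by simp
  next
    case 3
    have z: "charsum k * L_coeff (n - k) = 0" if "k \<in> {1..n} - {n - 2, n}" for k
    proof (cases "n - k = 1")
      case False
      hence "n - k \<ge> 3" using that by auto
      thus ?thesis by (simp add: L_coeff_ge_3)
    qed (simp add: L_coeff_1 assms(1) flip: One_nat_def)
    have "0 = (\<Sum>k=1..n. charsum k * L_coeff (n - k))"
      using L_coeff_recurrence[of n] L_coeff_ge_3[OF 3] by simp
    also have "\<dots> = (\<Sum>k\<in>{n - 2, n}. charsum k * L_coeff (n - k))"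
      using 3 z by (intro sum.mono_neutral_right) auto
    also have "\<dots> = charsum (n - 2) * int p + charsum n"
      using 3 L_coeff_2 L_coeff_0 by simp
    finally have "charsum n = - int p * charsum (n - 2)" by (simp add: algebra_simps)
    also have "charsum (n - 2) = (if odd (n - 2) then 0 else - 2 * (- int p) ^ ((n - 2) div 2))"
      using 3 by (intro less.IH) auto
    finally have "charsum n = (if odd (n - 2) then 0 else - 2 * (- int p) ^ Suc ((n - 2) div 2))"
      by simp
    moreover have "Suc ((n - 2) div 2) = n div 2" "odd (n - 2) = odd n" using 3 by presburger+
    ultimately show ?thesis by simp
  qed
qed

section \<open>The character sum over the prime field modulo p\<close>

lemma gnorm_1: "gnorm 1 y = y"
  by (simp add: gnorm_def)

lemma f_eq: "f u = u * (d * (u + 1)\<^sup>2 - (u - 1)\<^sup>2)"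
  by (simp add: f_def algebra_simps power2_eq_square power3_eq_cube)

lemma f_moebius:
  assumes "y \<noteq> 1"
  shows "f ((y + 1) / (y - 1)) = (2 / (y - 1)\<^sup>2)\<^sup>2 * ((1 - y\<^sup>2) * (1 - d * y\<^sup>2))"
proof -
  define w where "w = 1 / (y - 1)"
  have w: "w * (y - 1) = 1" using assms by (simp add: w_def)
  have "(y + 1) / (y - 1) = (y + 1) * w" by (simp add: w_def)
  moreover have "(y + 1) * w + w * (y - 1) = 2 * y * w" "(y + 1) * w - w * (y - 1) = 2 * w"
    by (simp_all add: algebra_simps)
  ultimately have "f ((y + 1) / (y - 1)) = (y + 1) * w * (d * (2 * y * w)\<^sup>2 - (2 * w)\<^sup>2)"
    by (simp only: f_eq w)
  \<comment> \<open>The inserted factor 1 raises w^3 to w^4, a square, and completes y + 1 to y^2 -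
    1.\<close>
  also have "\<dots> = (w * (y - 1)) * ((y + 1) * w * (d * (2 * y * w)\<^sup>2 - (2 * w)\<^sup>2))"
    by (simp add: w)
  also have "\<dots> = (2 * w\<^sup>2)\<^sup>2 * ((1 - y\<^sup>2) * (1 - d * y\<^sup>2))"
    by (simp add: algebra_simps power2_eq_square)
  also have "2 * w\<^sup>2 = 2 / (y - 1)\<^sup>2" by (simp add: w_def power_divide)
  finally show ?thesis .
qed

text \<open>
  The substitution \<open>u = (y + 1) / (y - 1)\<close>; the summand \<open>chi d\<close> comes from \<open>u = 1\<close>.
\<close>

lemma charsum_1_eq:
  "charsum 1 = chi d + (\<Sum>y\<in>gf 1. chi ((1 - y\<^sup>2) * (1 - d * y\<^sup>2)))"
proof -
  have fin: "finite (gf 1)" by (simp add: finite_gf)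
  have "f 1 = 2\<^sup>2 * d" by (simp add: f_eq)
  hence f1: "chi (f 1) = chi d"
    using chi_square_mult[OF gf_numeral d_in two_neq_0] by simp
  \<comment> \<open>The substitution is an involution of the prime field without 1, so it serves as
    its own inverse.\<close>
  have inv: "((u + 1) / (u - 1) + 1) / ((u + 1) / (u - 1) - 1) = u"
    "(u + 1) / (u - 1) \<in> gf 1 - {1}" if "u \<in> gf 1 - {1}" for u
  proof -
    have u: "u - 1 \<noteq> 0" "u \<in> gf 1" using that by auto
    have "(u + 1) + (u - 1) = 2 * u" "(u + 1) - (u - 1) = 2" by (simp_all add: algebra_simps)
    hence e: "(u + 1) / (u - 1) + 1 = 2 * u / (u - 1)" "(u + 1) / (u - 1) - 1 = 2 / (u - 1)"
      using u(1) by (metis add_divide_distrib divide_self, metis diff_divide_distrib divide_self)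
    thus "((u + 1) / (u - 1) + 1) / ((u + 1) / (u - 1) - 1) = u"
      using u two_neq_0 by simp
    have "(u + 1) / (u - 1) \<noteq> 1" using e(2) u two_neq_0 by auto
    moreover have "(u + 1) / (u - 1) \<in> gf 1" using u by (intro gf_divide gf_add gf_diff gf_1)
    ultimately show "(u + 1) / (u - 1) \<in> gf 1 - {1}" by blast
  qed
  have "charsum 1 = chi (f 1) + (\<Sum>u\<in>gf 1 - {1}. chi (f u))"
    unfolding charsum_def gnorm_1 by (rule sum.remove[OF fin gf_1])
  also have "(\<Sum>u\<in>gf 1 - {1}. chi (f u)) =
      (\<Sum>y\<in>gf 1 - {1}. chi ((1 - y\<^sup>2) * (1 - d * y\<^sup>2)))"
  proof (rule sum.reindex_bij_witness[of _ "\<lambda>y. (y + 1) / (y - 1)" "\<lambda>u. (u + 1) / (u - 1)"])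
    fix u assume u: "u \<in> gf 1 - {1}"
    show "((u + 1) / (u - 1) + 1) / ((u + 1) / (u - 1) - 1) = u"
      "(u + 1) / (u - 1) \<in> gf 1 - {1}" by (rule inv[OF u])+
    define y where "y = (u + 1) / (u - 1)"
    have y: "y \<noteq> 1" "y \<in> gf 1" "(y + 1) / (y - 1) = u" using inv[OF u] by (auto simp: y_def)
    have "f u = (2 / (y - 1)\<^sup>2)\<^sup>2 * ((1 - y\<^sup>2) * (1 - d * y\<^sup>2))"
      using f_moebius[OF y(1)] y(3) by simp
    moreover have "2 / (y - 1)\<^sup>2 \<in> gf 1" using y
      by (intro gf_divide gf_power gf_diff gf_1 gf_numeral)
    moreover have "(1 - y\<^sup>2) * (1 - d * y\<^sup>2) \<in> gf 1" using y d_in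
      by (intro gf_mult gf_power gf_diff gf_1)
    moreover have "2 / (y - 1)\<^sup>2 \<noteq> 0" using y(1) two_neq_0 by simp
    ultimately have "chi (f u) = chi ((1 - y\<^sup>2) * (1 - d * y\<^sup>2))"
      using chi_square_mult[of "2 / (y - 1)\<^sup>2"] by metis
    thus "chi ((1 - ((u + 1) / (u - 1))\<^sup>2) * (1 - d * ((u + 1) / (u - 1))\<^sup>2)) = chi (f u)"
      by (simp only: y_def)
  qed (fact inv)+
  \<comment> \<open>The added summand at y = 1 is 0.\<close>
  also have "\<dots> = (\<Sum>y\<in>gf 1. chi ((1 - y\<^sup>2) * (1 - d * y\<^sup>2)))"
    by (intro sum.mono_neutral_left fin) auto
  finally show ?thesis by (simp only: f1)
qed

lemma binomial_one_minus: "(1 - (z :: 'b)) ^ half_p = (\<Sum>i\<le>half_p. of_nat (half_p choose i) * (- 1) ^ i * z ^ i)"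
  using binomial_ring[of "- z" 1 half_p] by (simp add: power_minus[of z] mult.assoc)

text \<open>By Euler's criterion the summands become polynomials in y with exponents 2 (i + j).
  Power sums vanish except at p - 1 and 2 (p - 1), that is, at i + j = \<open>half_p\<close> and at
  i = j = \<open>half_p\<close>. The first case gives the squared binomials, by symmetry of the
  binomial coefficients.\<close>

lemma of_int_charsum_1:
  "of_int (charsum 1) = - ((- 1) ^ half_p * (\<Sum>j\<le>half_p. (of_nat (half_p choose j))\<^sup>2 * d ^ j))"
proof -
  let ?c = "\<lambda>i j. of_nat (half_p choose i) * of_nat (half_p choose j) * (- 1) ^ (i + j) * d ^ j"
  have pw: "(\<Sum>y\<in>gf 1. y ^ (2 * (i + j))) =
      - ((if i = half_p - j then 1 else 0) + (if i = half_p \<and> j = half_p then 1 else 0))"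
    if "i \<le> half_p" "j \<le> half_p" for i j
  proof -
    have "(i = half_p \<and> j = half_p) \<or> i + j < 2 * half_p" using that by (auto simp: le_less)
    then consider "i + j = half_p" | "i = half_p \<and> j = half_p" | "i + j \<noteq> half_p \<and> i + j < 2 * half_p" by blast
    thus ?thesis
    proof cases
      case 1
      hence "i = half_p - j" "\<not> (i = half_p \<and> j = half_p)" "2 * (i + j) = p - 1" using half_p_pos two_half_p by auto
      thus ?thesis using sum_power_eq_minus_1[of "p - 1"] p_ge_3 by simp
    next
      case 2
      hence "i \<noteq> half_p - j" "2 * (i + j) = 2 * (p - 1)" using half_p_pos two_half_p by auto
      moreover from this half_p_pos two_half_p have "(\<Sum>y\<in>gf 1. y ^ (2 * (i + j))) = - 1"
        by (intro sum_power_eq_minus_1) (simp, metis dvd_triv_right)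
      ultimately show ?thesis using 2 by simp
    next
      case 3
      hence "i \<noteq> half_p - j" "\<not> (i = half_p \<and> j = half_p)" "2 * (i + j) < 2 * (p - 1)" "2 * (i + j) \<noteq> p - 1"
        using two_half_p that by auto
      thus ?thesis using sum_power_eq_0[of "2 * (i + j)"] by simp
    qed
  qed
  have "(\<Sum>y\<in>gf 1. of_int (chi ((1 - y\<^sup>2) * (1 - d * y\<^sup>2)))) =
      (\<Sum>y\<in>gf 1. \<Sum>i\<le>half_p. \<Sum>j\<le>half_p. ?c i j * y ^ (2 * (i + j)))"
  proof (rule sum.cong[OF refl])
    fix y assume y: "y \<in> gf 1"
    have "(1 - y\<^sup>2) * (1 - d * y\<^sup>2) \<in> gf 1" using y d_in by (intro gf_mult gf_power gf_diff gf_1)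
    hence "of_int (chi ((1 - y\<^sup>2) * (1 - d * y\<^sup>2))) = (1 - y\<^sup>2) ^ half_p * (1 - d * y\<^sup>2) ^ half_p"
      by (simp only: of_int_chi power_mult_distrib)
    also have "\<dots> = (\<Sum>i\<le>half_p. \<Sum>j\<le>half_p. ?c i j * y ^ (2 * (i + j)))"
      unfolding binomial_one_minus sum_product
      by (intro sum.cong refl) (simp add: power_mult_distrib power_add power_mult)
    finally show "of_int (chi ((1 - y\<^sup>2) * (1 - d * y\<^sup>2))) = (\<Sum>i\<le>half_p. \<Sum>j\<le>half_p. ?c i j * y ^ (2 * (i + j)))" .
  qed
  also have "\<dots> = (\<Sum>i\<le>half_p. \<Sum>y\<in>gf 1. \<Sum>j\<le>half_p. ?c i j * y ^ (2 * (i + j)))" by (rule sum.swap)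
  also have "\<dots> = (\<Sum>i\<le>half_p. \<Sum>j\<le>half_p. \<Sum>y\<in>gf 1. ?c i j * y ^ (2 * (i + j)))"
    by (rule sum.cong[OF refl], rule sum.swap)
  also have "\<dots> = (\<Sum>i\<le>half_p. \<Sum>j\<le>half_p. ?c i j *
      - ((if i = half_p - j then 1 else 0) + (if i = half_p \<and> j = half_p then 1 else 0)))"
    by (intro sum.cong refl) (simp only: sum_distrib_left[symmetric] pw atMost_iff)
  also have "\<dots> = (\<Sum>j\<le>half_p. \<Sum>i\<le>half_p. ?c i j *
      - ((if i = half_p - j then 1 else 0) + (if i = half_p \<and> j = half_p then 1 else 0)))"
    by (rule sum.swap)
  also have "\<dots> = (\<Sum>j\<le>half_p. - ((- 1) ^ half_p * ((of_nat (half_p choose j))\<^sup>2 * d ^ j)) - (if j = half_p then d ^ half_p else 0))"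
  proof (rule sum.cong[OF refl])
    fix j assume "j \<in> {..half_p}"
    hence j: "j \<le> half_p" by simp
    have "(\<Sum>i\<le>half_p. ?c i j * - ((if i = half_p - j then 1 else 0) + (if i = half_p \<and> j = half_p then 1 else 0))) =
        (\<Sum>i\<le>half_p. (if i = half_p - j then - ?c i j else 0) + (if i = half_p then (if j = half_p then - ?c i j else 0) else 0))"
      by (intro sum.cong refl) auto
    also have "\<dots> = - ?c (half_p - j) j + (if j = half_p then - ?c half_p j else 0)"
      by (subst sum.distrib, subst (1 2) sum.delta) simp_all
    also have "\<dots> = - ((- 1) ^ half_p * ((of_nat (half_p choose j))\<^sup>2 * d ^ j)) - (if j = half_p then d ^ half_p else 0)"
      using j binomial_symmetric[OF j] by (simp add: power2_eq_square mult_ac)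
    finally show "(\<Sum>i\<le>half_p. ?c i j * - ((if i = half_p - j then 1 else 0) + (if i = half_p \<and> j = half_p then 1 else 0))) =
      - ((- 1) ^ half_p * ((of_nat (half_p choose j))\<^sup>2 * d ^ j)) - (if j = half_p then d ^ half_p else 0)" .
  qed
  also have "\<dots> = - ((- 1) ^ half_p * (\<Sum>j\<le>half_p. (of_nat (half_p choose j))\<^sup>2 * d ^ j)) - d ^ half_p"
    by (simp add: sum_subtractf sum_negf sum_distrib_left)
  \<comment> \<open>The term from i = j = \<open>half_p\<close> cancels the summand
    \<open>chi ?D\<close> of the point u = 1, written \<open>chi d\<close> here.\<close>
  finally show ?thesis
    unfolding charsum_1_eq by (simp add: of_int_chi[OF d_in])
qed

lemma charsum_1_eq_0:
  assumes "(\<Sum>j\<le>half_p. (of_nat (half_p choose j))\<^sup>2 * d ^ j) = 0"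
  shows "charsum 1 = 0"
proof -
  have "of_int (charsum 1) = (of_int 0 :: 'b)" by (simp only: of_int_charsum_1 assms) simp
  moreover have "\<bar>charsum 1\<bar> < int p"
  proof -
    \<comment> \<open>Without the vanishing summand at u = 0 there are p - 1 terms, which makes the
      bound strict.\<close>
    have "charsum 1 = (\<Sum>u\<in>gf 1 - {0}. chi (f u))"
      unfolding charsum_def gnorm_1
      by (rule sum.mono_neutral_right) (auto simp: finite_gf f_def)
    hence "\<bar>charsum 1\<bar> \<le> (\<Sum>u\<in>gf 1 - {0}. 1)"
      by (simp only:) (rule order_trans[OF sum_abs sum_mono], rule abs_chi_le)
    thus ?thesis using card_gf_1 p_ge_3 by (simp add: card_Diff_singleton)
  qed
  ultimately show ?thesis by (intro of_int_eqD) simp_all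
qed

end

section \<open>Transfer to a field with p^n elements\<close>

lemma finite_field_power_card:
  fixes x :: "'a::{finite, field}"
  shows "x ^ CARD('a) = x"
proof (cases "x = 0")
  case False
  have "(\<Prod>y\<in>UNIV - {0}. y) = (\<Prod>y\<in>UNIV - {0}. x * y)"
    by (rule prod.reindex_bij_witness[of _ "\<lambda>y. x * y" "\<lambda>y. y / x"]) (use False in auto)
  also have "\<dots> = x ^ (CARD('a) - 1) * (\<Prod>y\<in>UNIV - {0}. y)"
    by (simp add: prod.distrib card_Diff_singleton)
  finally have "x ^ (CARD('a) - 1) = 1" by simp
  moreover have "x ^ CARD('a) = x * x ^ (CARD('a) - 1)"
    by (simp flip: power_Suc)
  ultimately show ?thesis by simp
qed (simp add: power_0_left)

lemma CHAR_eq_of_card: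
  assumes "prime p" "CARD('a::{finite, field}) = p ^ n"
  shows "CHAR('a) = p"
proof -
  have "prime CHAR('a)" by (intro prime_CHAR_semidom finite_imp_CHAR_pos finite)
  moreover have "CHAR('a) dvd p ^ n" using CHAR_dvd_CARD[where 'a = 'a] assms(2) by simp
  ultimately have "CHAR('a) dvd p" by (rule prime_dvd_power)
  thus ?thesis using \<open>prime CHAR('a)\<close> assms(1) by (rule primes_dvd_imp_eq[rotated 2])
qed

theorem theorem3:
  fixes p n :: nat and d :: int
  assumes "prime p" and "odd p"
    and "\<not> [d = 0] (mod int p)" and "\<not> [d = 1] (mod int p)"
    and "[(\<Sum>j = 0..(p - 1) div 2. (int (((p - 1) div 2) choose j))\<^sup>2 * d ^ j) = 0] (mod int p)"
    and "n \<ge> 1"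
    and "CARD('a::{finite, field}) = p ^ n"
  shows "(odd n \<longrightarrow>
            int (card (edwards_completed (of_int d :: 'a))) = int p ^ n + 1 \<and>
            int (card (edwards_affine (of_int d :: 'a))) = int p ^ n - 1 - 2 * Legendre d (int p)) \<and>
         (even n \<longrightarrow>
            int (card (edwards_affine (of_int d :: 'a))) = int p ^ n - 3 - 2 * (- int p) ^ (n div 2) \<and>
            int (card (edwards_completed (of_int d :: 'a))) = int p ^ n + 1 - 2 * (- int p) ^ (n div 2))"
proof -
  let ?d = "of_int d :: 'a" and ?D = "of_int d :: 'a alg_closure"
  have char_a: "CHAR('a) = p" by (rule CHAR_eq_of_card[OF assms(1,7)])
  interpret odd_char p "TYPE('a alg_closure)"
    by standard (use assms(1,2) char_a in auto)
  have d: "?d \<noteq> 0" "?d \<noteq> 1"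
    using assms(3,4) of_int_eq_iff_cong_CHAR[of d 0, where 'a = 'a]
      of_int_eq_iff_cong_CHAR[of d 1, where 'a = 'a] by (simp_all add: char_a)
  hence D: "?D \<noteq> 0" "?D \<noteq> 1" by (simp_all flip: to_ac_of_int)
  interpret edwards_cubic p "TYPE('a alg_closure)" ?D
    by standard (use D in auto)
  have two: "(2 :: 'a) \<noteq> 0" using two_neq_0 by (metis to_ac_0 to_ac_numeral)

  \<comment> \<open>The embedded field satisfies x^(p^n) = x and has as many elements as the upper
    bound for \<open>gf n\<close> allows.\<close>
  have range_gf: "range to_ac = gf n"
  proof (rule card_subset_eq)
    show "finite (gf n)" using assms(6) by (simp add: finite_gf)
    show "range to_ac \<subseteq> gf n"
      using finite_field_power_card[where 'a = 'a] assms(7) by (auto simp: gf_def simp flip: to_ac_power)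
    hence "card (range (to_ac :: 'a \<Rightarrow> _)) \<le> card (gf n)"
      using assms(6) by (intro card_mono finite_gf) auto
    moreover have "card (range (to_ac :: 'a \<Rightarrow> _)) = p ^ n"
      using assms(7) by (simp add: card_image inj_to_ac)
    ultimately show "card (range (to_ac :: 'a \<Rightarrow> _)) = card (gf n)"
      using card_gf_le[of n] assms(6) by simp
  qed
  have roots: "int (card {v :: 'a. v\<^sup>2 = y}) = 1 + chi (gnorm n (to_ac y))" for y
  proof -
    have "to_ac ` {v. v\<^sup>2 = y} = {v \<in> gf n. v\<^sup>2 = to_ac y}"
      by (auto simp flip: range_gf to_ac_power)
    hence "card {v. v\<^sup>2 = y} = card {v \<in> gf n. v\<^sup>2 = to_ac y}"
      using card_image[OF inj_on_subset[OF inj_to_ac subset_UNIV], of "{v. v\<^sup>2 = y}"] by simp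
    moreover have "to_ac y \<in> gf n" using range_gf by blast
    ultimately show ?thesis using card_square_roots[of "to_ac y" n] assms(6) by simp
  qed

  have "charsum 1 = 0"
  proof (rule charsum_1_eq_0)
    have "of_int (\<Sum>j = 0..(p - 1) div 2. (int (((p - 1) div 2) choose j))\<^sup>2 * d ^ j) = (0 :: 'a alg_closure)"
      using assms(5) of_int_eq_0_iff by (simp only: cong_0_iff)
    thus "(\<Sum>j\<le>half_p. (of_nat (half_p choose j))\<^sup>2 * ?D ^ j) = 0"
      by (simp add: half_p_def atMost_atLeast0)
  qed
  hence S: "charsum n = (if odd n then 0 else - 2 * (- int p) ^ (n div 2))"
    using assms(6) by (rule charsum_eq)

  \<comment> \<open>Counted fibrewise: over u lie the square roots of the cubic at u.\<close>
  have "edwards_elliptic_affine ?d =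
      (SIGMA u:UNIV. {v. v\<^sup>2 = (?d - 1) * u ^ 3 + 2 * (?d + 1) * u\<^sup>2 + (?d - 1) * u})"
    by (auto simp: edwards_elliptic_affine_def)
  hence "int (card (edwards_elliptic_affine ?d)) = (\<Sum>u\<in>UNIV. 1 + chi (gnorm n (f (to_ac u))))"
    by (simp only: card_SigmaI finite of_nat_sum roots ball_UNIV finite_code)
      (simp add: f_def roots)
  also have "\<dots> = (\<Sum>u\<in>gf n. 1 + chi (gnorm n (f u)))"
    by (simp add: sum.reindex inj_to_ac flip: range_gf)
  also have "\<dots> = int p ^ n + charsum n"
    using assms(7) by (simp add: sum.distrib charsum_def card_image inj_to_ac flip: range_gf)
  finally have N: "int (card (edwards_completed ?d)) = int p ^ n + charsum n + 1"
    using card_edwards_completed_elliptic[OF two d] by simp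

  have "chi ?D = Legendre d (int p)"
  proof (rule chi_eqI)
    have "[Legendre d (int p) = d ^ ((p - 1) div 2)] (mod int p)"
      using euler_criterion[of p d] assms(1) p_ge_3 by simp
    thus "of_int (Legendre d (int p)) = ?D ^ half_p"
      using of_int_eq_iff_cong_CHAR[of "Legendre d (int p)" "d ^ half_p", where 'a = "'a alg_closure"]
      by (simp add: char_a half_p_def)
  qed (simp_all add: Legendre_def)
  \<comment> \<open>The norm of d is d^n. For even n, d is therefore a square and there are four
    points at infinity; for odd n the Legendre symbol decides between four and none.\<close>
  hence "chi (gnorm n (to_ac ?d)) = Legendre d (int p) ^ n"
    by (simp add: gnorm_gf_1 chi_power del: power_one_right)
  moreover have "Legendre d (int p) = 1 \<or> Legendre d (int p) = - 1"
    using assms(3) by (simp add: Legendre_def)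
  ultimately have "int (card {s. s\<^sup>2 = ?d}) = (if odd n then 1 + Legendre d (int p) else 2)"
    by (auto simp: roots)
  moreover have "int (card (edwards_completed ?d)) =
      int (card (edwards_affine ?d)) + 2 * int (card {s. s\<^sup>2 = ?d})"
    using card_edwards_completed[OF d(1)] by simp
  ultimately show ?thesis using N S by auto
qed

end
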